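(* Let $(W,W')$ be an exchangeable pair of $\mathbb{R}^d$-valued random vectors such that $\mathbb{E}W=0$ and $\mathbb{E}WW^t=\Sigma$, where $\Sigma\in\mathbb{R}^{d\times d}$ is symmetric and positive definite. Suppose further that $$\mathbb{E}^W(W'-W)=-\Lambda W+R$$ for an invertible $d\times d$ real matrix $\Lambda$ and a $\sigma(W)$-measurable $\mathbb{R}^d$-valued random vector $R=(R_1,\dots,R_d)^t$. Then, if $Z$ has the $d$-dimensional standard normal distribution, we have for every three times differentiable function $h:\mathbb{R}^d\to\mathbb{R}$ $$|\mathbb{E}h(W)-\mathbb{E}h(\Sigma^{1/2}Z)|\le \frac{|h|_2}{4}A+\frac{|h|_3}{12}B+\Big(|h|_1+\frac12 d\,\|\Sigma\|^{1/2}|h|_2\Big)C,$$ where, with $\lambda^{(i)}:=\sum_{m=1}^d|(\Lambda^{-1})_{m,i}|$, $$A=\sum_{i,j=1}^d\lambda^{(i)}\sqrt{\operatorname{Var}\,\mathbb{E}^W(W_i'-W_i)(W_j'-W_j)},$$ $$B=\sum_{i,j,k=1}^d\lambda^{(i)}\,\mathbb{E}|(W_i'-W_i)(W_j'-W_j)(W_k'-W_k)|,$$ $$C=\sum_{i=1}^d\lambda^{(i)}\sqrt{\operatorname{Var}R_i}.$$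
   Context: A pair $(W,W')$ is exchangeable if $(W,W')$ and $(W',W)$ have the same joint distribution. $\mathbb{E}^W(\cdot)$ denotes conditional expectation given $W$; $\operatorname{Var}\,\mathbb{E}^W X$ is the variance of the random variable $\mathbb{E}^W X$. Vectors are column vectors and $t$ denotes transpose. $\Sigma^{1/2}$ is the unique symmetric nonnegative definite square root of $\Sigma$. $\|\cdot\|$ denotes the supremum norm for both functions and matrices, so $\|\Sigma\|=\max_{i,j}|\Sigma_{i,j}|$. For a function $h:\mathbb{R}^d\to\mathbb{R}$, $|h|_1:=\sup_i\|\partial h/\partial x_i\|$, $|h|_2:=\sup_{i,j}\|\partial^2h/\partial x_i\partial x_j\|$, $|h|_3:=\sup_{i,j,k}\|\partial^3h/\partial x_i\partial x_j\partial x_k\|$, with values in $[0,\infty]$. If any of $|h|_1,|h|_2,|h|_3,A,B,C$ is infinite, the right-hand side of the bound is read as $+\infty$ (so the bound then has no content). *)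

theory Defs
  imports "HOL-Probability.Probability"
begin

subsection \<open>Matrices\<close>

definition positive_semidefinite :: "real^'n^'n \<Rightarrow> bool" where
  "positive_semidefinite S \<longleftrightarrow> (\<forall>x. 0 \<le> x \<bullet> (S *v x))"

definition positive_definite :: "real^'n^'n \<Rightarrow> bool" where
  "positive_definite S \<longleftrightarrow> (\<forall>x. x \<noteq> 0 \<longrightarrow> 0 < x \<bullet> (S *v x))"

definition matrix_sqrt :: "real^'n^'n \<Rightarrow> real^'n^'n" where
  "matrix_sqrt S = (THE Q. transpose Q = Q \<and> positive_semidefinite Q \<and> Q ** Q = S)"

definition matrix_sup_norm :: "real^'n^'n \<Rightarrow> real" where
  "matrix_sup_norm S = Max {\<bar>S $ i $ j\<bar> |i j. True}"

definition lambda_weight :: "real^'n^'n \<Rightarrow> 'n \<Rightarrow> real" where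
  "lambda_weight L i = (\<Sum>m\<in>UNIV. \<bar>matrix_inv L $ m $ i\<bar>)"


subsection \<open>Differentiability and derivative seminorms\<close>

text \<open>Differentiability is that of Frechet: \<open>D1\<close>, \<open>D2\<close>, \<open>D3\<close> are the iterated total derivatives.\<close>

definition three_times_differentiable :: "(real^'n \<Rightarrow> real) \<Rightarrow> bool" where
  "three_times_differentiable h \<longleftrightarrow>
    (\<exists>(D1 :: real^'n \<Rightarrow> ((real^'n) \<Rightarrow>\<^sub>L real))
      (D2 :: real^'n \<Rightarrow> ((real^'n) \<Rightarrow>\<^sub>L ((real^'n) \<Rightarrow>\<^sub>L real)))
      (D3 :: real^'n \<Rightarrow> ((real^'n) \<Rightarrow>\<^sub>L ((real^'n) \<Rightarrow>\<^sub>L ((real^'n) \<Rightarrow>\<^sub>L real)))).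
      \<forall>x. (h has_derivative blinfun_apply (D1 x)) (at x) \<and>
          (D1 has_derivative blinfun_apply (D2 x)) (at x) \<and>
          (D2 has_derivative blinfun_apply (D3 x)) (at x))"

definition partial_deriv :: "'n \<Rightarrow> (real^'n \<Rightarrow> real) \<Rightarrow> real^'n \<Rightarrow> real" where
  "partial_deriv i h x = deriv (\<lambda>t. h (x + t *\<^sub>R axis i 1)) 0"

definition sup_norm :: "(real^'n \<Rightarrow> real) \<Rightarrow> ennreal" where
  "sup_norm f = (SUP x. ennreal \<bar>f x\<bar>)"

definition deriv_norm1 :: "(real^'n \<Rightarrow> real) \<Rightarrow> ennreal" where
  "deriv_norm1 h = (SUP i. sup_norm (partial_deriv i h))"

definition deriv_norm2 :: "(real^'n \<Rightarrow> real) \<Rightarrow> ennreal" where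
  "deriv_norm2 h = (SUP i. SUP j. sup_norm (partial_deriv i (partial_deriv j h)))"

definition deriv_norm3 :: "(real^'n \<Rightarrow> real) \<Rightarrow> ennreal" where
  "deriv_norm3 h =
    (SUP i. SUP j. SUP k. sup_norm (partial_deriv i (partial_deriv j (partial_deriv k h))))"


subsection \<open>Random vectors\<close>

definition exchangeable_pair :: "'a measure \<Rightarrow> ('a \<Rightarrow> 'b::topological_space) \<Rightarrow> ('a \<Rightarrow> 'b) \<Rightarrow> bool" where
  "exchangeable_pair M W W' \<longleftrightarrow>
    W \<in> borel_measurable M \<and> W' \<in> borel_measurable M \<and>
    distr M (borel \<Otimes>\<^sub>M borel) (\<lambda>\<omega>. (W \<omega>, W' \<omega>)) =
    distr M (borel \<Otimes>\<^sub>M borel) (\<lambda>\<omega>. (W' \<omega>, W \<omega>))"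

definition sigma_gen :: "'a measure \<Rightarrow> ('a \<Rightarrow> 'b::topological_space) \<Rightarrow> 'a measure" where
  "sigma_gen M W = vimage_algebra (space M) W borel"

definition cond_exp_given ::
  "'a measure \<Rightarrow> ('a \<Rightarrow> 'b::topological_space) \<Rightarrow> ('a \<Rightarrow> real) \<Rightarrow> 'a \<Rightarrow> real" where
  "cond_exp_given M W X = real_cond_exp M (sigma_gen M W) X"

definition standard_normal_vector :: "'b measure \<Rightarrow> ('b \<Rightarrow> real^'n) \<Rightarrow> bool" where
  "standard_normal_vector N Z \<longleftrightarrow>
    distributed N lborel Z (\<lambda>z. ennreal (\<Prod>i\<in>UNIV. std_normal_density (z $ i)))"

text \<open>
  The library's real-valued variance is \<open>0\<close> when the second moment is infinite, so the variance
  is taken here in \<open>[0, \<infinity>]\<close>. It is meant for integrable \<open>X\<close>, the centring being a Bochner integral.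
\<close>

definition evariance :: "'a measure \<Rightarrow> ('a \<Rightarrow> real) \<Rightarrow> ennreal" where
  "evariance M X = (\<integral>\<^sup>+\<omega>. ennreal ((X \<omega> - integral\<^sup>L M X)\<^sup>2) \<partial>M)"

definition ennreal_sqrt :: "ennreal \<Rightarrow> ennreal" where
  "ennreal_sqrt v = (if v = \<infinity> then \<infinity> else ennreal (sqrt (enn2real v)))"


subsection \<open>The quantities in the bound\<close>

definition stein_A ::
  "'a measure \<Rightarrow> ('a \<Rightarrow> real^'n) \<Rightarrow> ('a \<Rightarrow> real^'n) \<Rightarrow> real^'n^'n \<Rightarrow> ennreal" where
  "stein_A M W W' L =
    (\<Sum>i\<in>UNIV. \<Sum>j\<in>UNIV. ennreal (lambda_weight L i) *
      ennreal_sqrt (evariance M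
        (cond_exp_given M W (\<lambda>\<omega>. (W' \<omega> $ i - W \<omega> $ i) * (W' \<omega> $ j - W \<omega> $ j)))))"

definition stein_B ::
  "'a measure \<Rightarrow> ('a \<Rightarrow> real^'n) \<Rightarrow> ('a \<Rightarrow> real^'n) \<Rightarrow> real^'n^'n \<Rightarrow> ennreal" where
  "stein_B M W W' L =
    (\<Sum>i\<in>UNIV. \<Sum>j\<in>UNIV. \<Sum>k\<in>UNIV. ennreal (lambda_weight L i) *
      (\<integral>\<^sup>+\<omega>. ennreal \<bar>(W' \<omega> $ i - W \<omega> $ i) * (W' \<omega> $ j - W \<omega> $ j) * (W' \<omega> $ k - W \<omega> $ k)\<bar> \<partial>M))"

definition stein_C :: "'a measure \<Rightarrow> ('a \<Rightarrow> real^'n) \<Rightarrow> real^'n^'n \<Rightarrow> ennreal" where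
  "stein_C M R L =
    (\<Sum>i\<in>UNIV. ennreal (lambda_weight L i) * ennreal_sqrt (evariance M (\<lambda>\<omega>. R \<omega> $ i)))"

text \<open>
  The explicit case distinction is needed because \<open>0 * \<infinity> = 0\<close> in \<^typ>\<open>ennreal\<close>, whereas the bound
  is read as \<open>\<infinity>\<close> as soon as one of its ingredients is infinite.
\<close>

definition stein_bound ::
  "real^'n^'n \<Rightarrow> (real^'n \<Rightarrow> real) \<Rightarrow> ennreal \<Rightarrow> ennreal \<Rightarrow> ennreal \<Rightarrow> ennreal" where
  "stein_bound S h A B C =
    (if \<infinity> \<in> {deriv_norm1 h, deriv_norm2 h, deriv_norm3 h, A, B, C} then \<infinity>
     else deriv_norm2 h / 4 * A + deriv_norm3 h / 12 * B
       + (deriv_norm1 h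
          + ennreal (1/2 * real CARD('n) * sqrt (matrix_sup_norm S)) * deriv_norm2 h) * C)"

end

theory Submission
  imports Defs
begin

text \<open>
  Instead of solving the Stein equation, interpolate: on the product of the two probability spaces
  put \<open>X\<^sub>t = sin t W + cos t \<Sigma>\<^sup>1\<^sup>/\<^sup>2 Z\<close> and \<open>\<phi> t = E h(X\<^sub>t)\<close>, so that
  the difference to be bounded is \<open>\<phi> (\<pi>/2) - \<phi> 0\<close>. Gaussian integration by parts turns \<open>\<phi>' t\<close> into
  \<open>cos t\<close> times \<open>E [W \<bullet> F(W) - tr (\<Sigma> DF(W))]\<close> for the vector field
  \<open>F x = \<nabla>h (sin t x + cos t y)\<close>, averaged over \<open>y = \<Sigma>\<^sup>1\<^sup>/\<^sup>2 Z\<close>. For each fixed \<open>y\<close> the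
  exchangeable pair bounds this expectation: antisymmetry gives
  \<open>E [(W' - W)\<^sub>i (F\<^sub>m W' - F\<^sub>m W)] = - 2 E [(W' - W)\<^sub>i F\<^sub>m W]\<close>, the right-hand side is evaluated by the
  regression property and the left-hand side by a Taylor expansion. The \<open>k\<close>-th derivatives
  of \<open>h\<close> come with a factor \<open>cos t sin\<^sup>k\<^sup>-\<^sup>1 t\<close>, whose integral over \<open>[0, \<pi>/2]\<close> is \<open>1/k\<close>; these are the
  constants of the classical bounds for the solution of the Stein equation.
\<close>

subsection \<open>Matrices: square root, inverse and supremum norm\<close>

lemma symmetric_matrix_inner:
  fixes S :: "real^'n^'n"
  assumes "transpose S = S"
  shows "(S *v x) \<bullet> y = x \<bullet> (S *v y)"
  using dot_lmul_matrix[of x S y] by (metis assms transpose_matrix_vector inner_commute)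

text \<open>The quadratic form attains its minimum on the compact unit sphere; that minimum is
  positive, and homogeneity carries the bound to all vectors.\<close>

lemma positive_definite_coercive:
  fixes S :: "real^'n^'n"
  assumes "positive_definite S"
  obtains a where "a > 0" "\<And>x. a * (norm x)\<^sup>2 \<le> x \<bullet> (S *v x)"
proof -
  have "\<exists>u \<in> sphere (0::real^'n) 1. \<forall>y \<in> sphere 0 1. u \<bullet> (S *v u) \<le> y \<bullet> (S *v y)"
  proof (rule continuous_attains_inf)
    show "sphere (0::real^'n) 1 \<noteq> {}"
      by simp
    show "continuous_on (sphere 0 1) (\<lambda>x. x \<bullet> (S *v x))"
      by (intro continuous_intros matrix_vector_mult_linear_continuous_on)
  qed simp
  then obtain u where u: "norm u = 1" and min: "\<And>y. norm y = 1 \<Longrightarrow> u \<bullet> (S *v u) \<le> y \<bullet> (S *v y)"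
    by auto
  show thesis
  proof
    have "u \<noteq> 0" using u by auto
    then show "u \<bullet> (S *v u) > 0" using assms by (auto simp: positive_definite_def)
    fix x
    show "u \<bullet> (S *v u) * (norm x)\<^sup>2 \<le> x \<bullet> (S *v x)"
    proof (cases "x = 0")
      case False
      define y where "y = x /\<^sub>R norm x"
      have "norm y = 1" and x: "x = norm x *\<^sub>R y" using False by (auto simp: y_def)
      have "x \<bullet> (S *v x) = (norm x)\<^sup>2 * (y \<bullet> (S *v y))"
        by (subst (1 2) x) (simp add: matrix_vector_mult_scaleR power2_eq_square mult.assoc del: scaleR_right_distrib)
      then show ?thesis using min[OF \<open>norm y = 1\<close>] by (simp add: mult.commute[of "(norm x)\<^sup>2"] mult_right_mono)
    qed simp
  qed
qed

text \<open>With \<open>B = 1 - S/c\<close> a contraction, the Banach fixed point \<open>Y = (B + Y\<^sup>2)/2\<close>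
  satisfies \<open>(1 - Y)\<^sup>2 = S/c\<close>.\<close>

lemma positive_definite_sqrt_exists:
  fixes S :: "real^'n^'n"
  assumes sym: "transpose S = S" and pd: "positive_definite S"
  obtains Q where "transpose Q = Q" "positive_definite Q" "Q ** Q = S"
proof -
  define A where "A = Blinfun ((*v) S)"
  have A: "blinfun_apply A x = S *v x" for x
    unfolding A_def by (simp add: bounded_linear_Blinfun_apply matrix_vector_mul_bounded_linear)
  obtain a where a: "a > 0" "\<And>x. a * (norm x)\<^sup>2 \<le> x \<bullet> (S *v x)"
    using positive_definite_coercive[OF pd] by blast
  define K where "K = norm A"
  have K: "norm (S *v x) \<le> K * norm x" for x
    using norm_blinfun[of A x] by (simp add: A K_def)
  have aK: "a \<le> K"
  proof -
    obtain i :: 'n where True by simp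
    define u :: "real^'n" where "u = axis i 1"
    have u: "norm u = 1" by (simp add: u_def)
    have "a \<le> u \<bullet> (S *v u)" using a(2)[of u] u by simp
    also have "\<dots> \<le> norm u * norm (S *v u)" by (rule norm_cauchy_schwarz)
    also have "\<dots> \<le> K" using K[of u] u by simp
    finally show ?thesis .
  qed
  \<comment> \<open>For s = 1/c the estimate below reads \<open>(norm (B x))\<^sup>2 \<le> (1 - 2 *
    a * s + K\<^sup>2 * s\<^sup>2) * (norm x)\<^sup>2\<close>. The choice s = a / K^2 minimises the
    factor, and the minimum is the square of \<beta>.\<close>
  define c where "c = K\<^sup>2 / a"
  have Kp: "K > 0" and c: "c > 0" using a aK by (auto simp: c_def)
  define \<beta> where "\<beta> = sqrt (1 - a\<^sup>2 / K\<^sup>2)"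
  have aK1: "a\<^sup>2 / K\<^sup>2 \<le> 1" "a\<^sup>2 / K\<^sup>2 > 0" using aK a(1) Kp by (auto simp: power_mono)
  have b0: "0 \<le> \<beta>" "\<beta> < 1" and b2: "\<beta>\<^sup>2 = 1 - a\<^sup>2 / K\<^sup>2"
    using aK1 by (auto simp: \<beta>_def)
  define B :: "(real^'n) \<Rightarrow>\<^sub>L (real^'n)" where "B = id_blinfun - (1/c) *\<^sub>R A"
  have B: "blinfun_apply B x = x - (1/c) *\<^sub>R (S *v x)" for x
    by (simp add: B_def blinfun.diff_left blinfun.scaleR_left A)
  have nB: "norm B \<le> \<beta>"
  proof (rule norm_blinfun_bound[OF b0(1)])
    fix x
    have "(norm (B x))\<^sup>2 = (norm x)\<^sup>2 - 2 / c * (x \<bullet> (S *v x)) + (norm (S *v x))\<^sup>2 / c\<^sup>2"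
      unfolding B power2_norm_eq_inner
      by (simp add: inner_diff_left inner_diff_right inner_commute field_simps power2_eq_square)
    also have "\<dots> \<le> (norm x)\<^sup>2 - 2 / c * (a * (norm x)\<^sup>2) + (K * norm x)\<^sup>2 / c\<^sup>2"
      using a(2)[of x] K[of x] c
      by (intro add_mono diff_mono mult_left_mono divide_right_mono power_mono) auto
    also have "\<dots> = \<beta>\<^sup>2 * (norm x)\<^sup>2"
      unfolding b2 using a(1) Kp by (simp add: c_def field_simps power2_eq_square)
    finally show "norm (B x) \<le> \<beta> * norm x"
      using b0 by (metis power2_le_imp_le power_mult_distrib mult_nonneg_nonneg norm_ge_zero)
  qed
  have symB: "B x \<bullet> y = x \<bullet> B y" for x y
    by (simp add: B inner_diff_left inner_diff_right symmetric_matrix_inner[OF sym])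
  \<comment> \<open>Self-adjointness is a closed condition preserved by \<open>T\<close>, so it is
    built into the space and passes to the fixed point. The ball of radius \<beta> is mapped into
    itself because (\<beta> + \<beta>^2) / 2 \<le> \<beta>, and on it \<open>T\<close> contracts by
    the factor \<beta>.\<close>
  define X where "X = {Y :: (real^'n) \<Rightarrow>\<^sub>L (real^'n). norm Y \<le> \<beta> \<and> (\<forall>x y. blinfun_apply Y x \<bullet> y = x \<bullet> blinfun_apply Y y)}"
  define T where "T Y = (1/2) *\<^sub>R (B + (Y o\<^sub>L Y))" for Y
  have "closed X"
    unfolding X_def by (intro closed_Collect_conj closed_Collect_all closed_Collect_le closed_Collect_eq continuous_intros)
  then have "Topological_Spaces.complete X" by (simp add: complete_eq_closed)
  moreover have "X \<noteq> {}" using b0 by (auto simp: X_def intro!: exI[of _ 0])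
  moreover have "T ` X \<subseteq> X"
  proof safe
    fix Y assume Y: "Y \<in> X"
    have "norm (T Y) \<le> (norm B + norm Y * norm Y) / 2"
      using norm_triangle_ineq[of B "Y o\<^sub>L Y"] norm_blinfun_compose[of Y Y] by (simp add: T_def)
    also have "\<dots> \<le> (\<beta> + 1 * \<beta>) / 2"
      using Y nB b0 by (intro divide_right_mono add_mono mult_mono) (auto simp: X_def)
    finally have "norm (T Y) \<le> \<beta>" by simp
    moreover have "T Y x \<bullet> y = x \<bullet> T Y y" for x y
      using Y symB by (simp add: T_def X_def blinfun.scaleR_left blinfun.add_left inner_add_left inner_add_right)
    ultimately show "T Y \<in> X" by (simp add: X_def)
  qed
  moreover have "\<forall>Y\<in>X. \<forall>Z\<in>X. dist (T Y) (T Z) \<le> \<beta> * dist Y Z"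
  proof safe
    fix Y Z assume Y: "Y \<in> X" and Z: "Z \<in> X"
    \<comment> \<open>The factorisation Y^2 - Z^2 = Y (Y - Z) + (Y - Z) Z is valid also for
      operators that do not commute.\<close>
    have "T Y - T Z = (1/2) *\<^sub>R ((Y o\<^sub>L (Y - Z)) + ((Y - Z) o\<^sub>L Z))"
      by (rule blinfun_eqI)
        (simp add: T_def blinfun.scaleR_left blinfun.add_left blinfun.diff_left blinfun.diff_right algebra_simps)
    then have "norm (T Y - T Z) = norm ((Y o\<^sub>L (Y - Z)) + ((Y - Z) o\<^sub>L Z)) / 2" by simp
    also have "\<dots> \<le> (norm Y * norm (Y - Z) + norm (Y - Z) * norm Z) / 2"
      by (intro divide_right_mono order.trans[OF norm_triangle_ineq] add_mono norm_blinfun_compose) auto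
    also have "\<dots> \<le> (\<beta> * norm (Y - Z) + norm (Y - Z) * \<beta>) / 2"
      using Y Z b0 by (intro divide_right_mono add_mono mult_mono) (auto simp: X_def)
    finally show "dist (T Y) (T Z) \<le> \<beta> * dist Y Z" by (simp add: dist_norm mult.commute)
  qed
  ultimately obtain Y where Y: "Y \<in> X" "T Y = Y"
    using Banach_fix[of X \<beta> T] b0 by blast
  have symY: "Y x \<bullet> y = x \<bullet> Y y" and nY: "norm (Y x) \<le> \<beta> * norm x" for x y
    using Y(1) norm_blinfun[of Y x] mult_right_mono[of "norm Y" \<beta> "norm x"] by (auto simp: X_def)
  define P where "P x = sqrt c *\<^sub>R (x - Y x)" for x
  have linP: "linear P"
    by (rule linearI) (simp_all add: P_def blinfun.add_right blinfun.scaleR_right algebra_simps)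
  define Q where "Q = matrix P"
  have Q: "Q *v x = P x" for x
    unfolding Q_def by (simp add: linP matrix_works)
  have PP: "P (P x) = S *v x" for x
  proof -
    have "Y x = (1/2) *\<^sub>R (B x + Y (Y x))"
      using arg_cong[OF Y(2), of "\<lambda>F. blinfun_apply F x"]
      by (simp add: T_def blinfun.scaleR_left blinfun.add_left)
    then have "2 *\<^sub>R Y x = B x + Y (Y x)" by (metis scaleR_half_double scaleR_scaleR scaleR_2 scaleR_right_distrib)
    then have YY: "Y (Y x) = 2 *\<^sub>R Y x - B x" by simp
    have "P (P x) = c *\<^sub>R (x - 2 *\<^sub>R Y x + Y (Y x))"
      using c by (simp add: P_def blinfun.diff_right blinfun.scaleR_right algebra_simps scaleR_2)
    also have "\<dots> = S *v x" using c by (simp add: YY B)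
    finally show ?thesis .
  qed
  have symP: "P x \<bullet> y = x \<bullet> P y" for x y
    by (simp add: P_def inner_diff_left inner_diff_right symY)
  show thesis
  proof
    have "(Q *v axis j 1) $ i = (transpose Q *v axis j 1) $ i" for i j
    proof -
      have "(Q *v axis j 1) $ i = (P (axis j 1)) \<bullet> axis i 1" by (simp add: Q inner_axis)
      also have "\<dots> = P (axis i 1) \<bullet> axis j 1" using symP inner_commute by metis
      finally show ?thesis
        by (simp add: matrix_vector_mult_basis column_def transpose_def inner_axis flip: Q)
    qed
    then show "transpose Q = Q"
      by (simp add: vec_eq_iff matrix_vector_mult_basis column_def transpose_def)
    show "positive_definite Q"
      unfolding positive_definite_def
    proof safe
      fix x :: "real^'n" assume "x \<noteq> 0"
      \<comment> \<open>As the norm of \<open>Y\<close> is at most \<beta> < 1, the operator 1 - Y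
        is positive definite.\<close>
      have "x \<bullet> Y x \<le> norm x * norm (Y x)" by (rule norm_cauchy_schwarz)
      also have "\<dots> \<le> norm x * (\<beta> * norm x)" using nY by (intro mult_left_mono) auto
      also have "\<dots> = \<beta> * (x \<bullet> x)" by (simp add: dot_square_norm power2_eq_square)
      also have "\<dots> < x \<bullet> x" using \<open>x \<noteq> 0\<close> b0 by (simp add: inner_gt_zero_iff)
      finally show "0 < x \<bullet> (Q *v x)" using c by (simp add: Q P_def inner_diff_right)
    qed
    show "Q ** Q = S"
      by (subst matrix_eq) (simp add: Q PP flip: matrix_vector_mul_assoc)
  qed
qed

text \<open>With D = P - Q, equality of the squares gives P D = - D Q. Multiplying by D and taking
  traces, tr (D P D) = - tr (D Q D). Both traces are nonnegative, hence zero, and positive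
  definiteness of P then forces every column of D to vanish. One positive definite root thus
  excludes all other symmetric nonnegative definite ones.\<close>

lemma square_eq_imp_eq_positive_definite:
  fixes P Q :: "real^'n^'n"
  assumes P: "transpose P = P" "positive_definite P"
    and Q: "transpose Q = Q" "positive_semidefinite Q"
    and eq: "P ** P = Q ** Q"
  shows "P = Q"
proof -
  define D where "D = P - Q"
  have symD: "transpose D = D" using P Q by (simp add: D_def transpose_def vec_eq_iff)
  have "P *v (P *v x) = Q *v (Q *v x)" for x
    using eq by (simp add: matrix_vector_mul_assoc)
  then have sylv: "P *v (D *v x) = - (D *v (Q *v x))" for x
    by (simp add: D_def matrix_vector_mult_diff_rdistrib matrix_vector_mult_diff_distrib)
  have 1: "(\<Sum>i\<in>UNIV. (D *v axis i 1) \<bullet> (P *v (D *v axis i 1)))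
      = - (\<Sum>i\<in>UNIV. (D *v axis i 1) \<bullet> (Q *v (D *v axis i 1)))" (is "?L = - ?R")
  proof -
    \<comment> \<open>Cyclicity of the trace, tr (U^t V) = tr (V U^t), written out on the coordinate
      axes.\<close>
    have tr: "(\<Sum>i\<in>UNIV. (U *v axis i 1) \<bullet> (V *v axis i 1))
        = (\<Sum>i\<in>UNIV. (transpose V *v axis i 1) \<bullet> (transpose U *v axis i 1))" for U V :: "real^'n^'n"
      by (simp add: inner_vec_def matrix_vector_mult_basis column_def transpose_def mult.commute)
        (rule sum.swap)
    have "?L = - (\<Sum>i\<in>UNIV. (D *v axis i 1) \<bullet> ((D ** Q) *v axis i 1))"
      by (simp add: sylv sum_negf flip: matrix_vector_mul_assoc)
    also have "\<dots> = - (\<Sum>i\<in>UNIV. ((Q ** D) *v axis i 1) \<bullet> (D *v axis i 1))"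
      by (simp add: tr[of D "D ** Q"] matrix_transpose_mul symD Q(1))
    finally show ?thesis by (simp add: inner_commute flip: matrix_vector_mul_assoc)
  qed
  have nn: "0 \<le> x \<bullet> (P *v x)" "0 \<le> x \<bullet> (Q *v x)" for x
    using P(2) Q(2) by (cases "x = 0"; force simp: positive_definite_def positive_semidefinite_def)+
  have "?L = 0"
    using 1 sum_nonneg[of UNIV "\<lambda>i. (D *v axis i 1) \<bullet> (P *v (D *v axis i 1))"]
      sum_nonneg[of UNIV "\<lambda>i. (D *v axis i 1) \<bullet> (Q *v (D *v axis i 1))"] nn by fastforce
  then have "(D *v axis i 1) \<bullet> (P *v (D *v axis i 1)) = 0" for i
    using nn by (subst (asm) sum_nonneg_eq_0_iff) auto
  then have "D *v axis i 1 = 0" for i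
    using P(2) unfolding positive_definite_def by (metis less_irrefl)
  then have "D = 0" by (simp add: vec_eq_iff matrix_vector_mult_basis column_def)
  then show ?thesis by (simp add: D_def)
qed

text \<open>Existence and uniqueness together resolve the definite description in
  \<open>matrix_sqrt\<close>. Symmetry and the value of the square are the properties that the
  interpolation uses.\<close>

lemma matrix_sqrt_positive_definite:
  fixes S :: "real^'n^'n"
  assumes "transpose S = S" "positive_definite S"
  shows "transpose (matrix_sqrt S) = matrix_sqrt S" "matrix_sqrt S ** matrix_sqrt S = S"
proof -
  obtain Q where Q: "transpose Q = Q" "positive_definite Q" "Q ** Q = S"
    using positive_definite_sqrt_exists[OF assms] by blast
  have psd: "positive_semidefinite Q"
    unfolding positive_semidefinite_def
  proof
    fix x show "0 \<le> x \<bullet> (Q *v x)"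
      using Q(2) by (cases "x = 0") (auto simp: positive_definite_def less_imp_le)
  qed
  have "matrix_sqrt S = Q"
    unfolding matrix_sqrt_def
    by (rule the_equality) (use Q psd square_eq_imp_eq_positive_definite in \<open>metis+\<close>)
  then show "transpose (matrix_sqrt S) = matrix_sqrt S" "matrix_sqrt S ** matrix_sqrt S = S"
    using Q by auto
qed

section \<open>Inverse matrix, weights and largest entry\<close>

lemma matrix_inv_both:
  fixes L :: "real^'n^'n"
  assumes "invertible L"
  shows "L ** matrix_inv L = mat 1" "matrix_inv L ** L = mat 1"
  using assms someI_ex[of "\<lambda>A. L ** A = mat 1 \<and> A ** L = mat 1"]
  unfolding invertible_def matrix_inv_def by auto

lemma matrix_inv_cancel:
  fixes L :: "real^'n^'n"
  assumes "invertible L"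
  shows "(\<Sum>i\<in>UNIV. matrix_inv L $ m $ i * (\<Sum>k\<in>UNIV. L $ i $ k * x k)) = x m"
proof -
  have "(matrix_inv L *v (L *v (\<chi> k. x k))) $ m = x m"
    by (simp add: matrix_vector_mul_assoc matrix_inv_both[OF assms])
  then show ?thesis by (simp add: matrix_vector_mult_def)
qed

text \<open>A zero weight would mean a zero column of the inverse. Strict positivity matters because
  0 * \<infinity> = 0 in \<open>ennreal\<close>: only with positive weights does finiteness of the
  weighted sums A, B, C imply finiteness of each variance and each third moment in them.\<close>

lemma lambda_weight_pos:
  assumes "invertible L"
  shows "lambda_weight L i > 0"
proof -
  have "lambda_weight L i \<noteq> 0"
  proof
    assume "lambda_weight L i = 0"
    then have "matrix_inv L $ m $ i = 0" for m
      unfolding lambda_weight_def by (subst (asm) sum_nonneg_eq_0_iff) auto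
    then have "(L ** matrix_inv L) $ i $ i = 0" by (simp add: matrix_matrix_mult_def)
    then show False by (simp add: matrix_inv_both[OF assms] mat_def)
  qed
  then show ?thesis unfolding lambda_weight_def by (simp add: sum_nonneg order.not_eq_order_implies_strict)
qed

lemma abs_le_matrix_sup_norm: "\<bar>S $ i $ j\<bar> \<le> matrix_sup_norm S"
proof -
  have "{\<bar>S $ i $ j\<bar> |i j. True} = (\<lambda>(i, j). \<bar>S $ i $ j\<bar>) ` UNIV" by auto
  then show ?thesis unfolding matrix_sup_norm_def by (intro Max_ge) auto
qed

subsection \<open>Partial derivatives and Taylor expansion\<close>

lemma sup_norm_le_imp_abs_le:
  assumes "sup_norm f \<le> B" "B < \<infinity>"
  shows "\<bar>f x\<bar> \<le> enn2real B"
proof -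
  have "ennreal \<bar>f x\<bar> \<le> B"
    using assms(1) unfolding sup_norm_def by (meson SUP_le_iff UNIV_I)
  then show ?thesis using assms(2) by (metis enn2real_ennreal enn2real_mono abs_ge_zero infinity_ennreal_def)
qed

lemma has_real_derivative_along_line:
  fixes f :: "'a::real_normed_vector \<Rightarrow> real"
  assumes "\<And>x. (f has_derivative F x) (at x)"
  shows "((\<lambda>t. f (x + t *\<^sub>R v)) has_real_derivative F (x + t *\<^sub>R v) v) (at t)"
proof -
  have "((\<lambda>t. f (x + t *\<^sub>R v)) has_derivative (\<lambda>s. F (x + t *\<^sub>R v) (s *\<^sub>R v))) (at t)"
    by (rule has_derivative_compose[OF _ assms]) (auto intro!: derivative_eq_intros)
  moreover have "F (x + t *\<^sub>R v) (s *\<^sub>R v) = F (x + t *\<^sub>R v) v * s" for s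
    using linear_scale[OF has_derivative_linear[OF assms], of _ s v] by simp
  ultimately show ?thesis by (simp add: has_field_derivative_def)
qed

lemma partial_deriv_eq:
  assumes "\<And>x. (f has_derivative F x) (at x)"
  shows "partial_deriv i f = (\<lambda>x. F x (axis i 1))"
  unfolding partial_deriv_def
  using has_real_derivative_along_line[OF assms, of _ "axis i 1" 0] by (auto intro!: DERIV_imp_deriv)

lemma linear_eq_sum_axis:
  fixes F :: "real^'n \<Rightarrow> real"
  assumes "linear F"
  shows "F v = (\<Sum>m\<in>UNIV. F (axis m 1) * v $ m)"
proof -
  have "F v = F (\<Sum>m\<in>UNIV. v $ m *\<^sub>R axis m 1)" by (simp add: basis_expansion scalar_mult_eq_scaleR[symmetric])
  then show ?thesis by (simp add: linear_sum[OF assms] linear_scale[OF assms] mult.commute)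
qed

lemma has_derivative_sum_axis:
  fixes F :: "real^'n \<Rightarrow> real"
  assumes "(f has_derivative F) net"
  shows "(f has_derivative (\<lambda>v. \<Sum>m\<in>UNIV. F (axis m 1) * v $ m)) net"
proof -
  have "F = (\<lambda>v. \<Sum>m\<in>UNIV. F (axis m 1) * v $ m)"
    using linear_eq_sum_axis[OF has_derivative_linear[OF assms]] by (rule ext)
  then show ?thesis using assms by metis
qed

text \<open>The mean value inequality along the segment, with the derivative expanded on the
  coordinate axes. Measuring the increment coordinatewise is what later produces exactly the
  products of three increments in \<open>stein_B\<close>.\<close>

lemma abs_diff_le_of_partials:
  fixes f :: "real^'n \<Rightarrow> real"
  assumes "\<And>x. (f has_derivative F x) (at x)" "\<And>k x. \<bar>F x (axis k 1)\<bar> \<le> c"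
  shows "\<bar>f y - f x\<bar> \<le> c * (\<Sum>k\<in>UNIV. \<bar>y $ k - x $ k\<bar>)"
proof -
  have "\<bar>F z (y - x)\<bar> \<le> c * (\<Sum>k\<in>UNIV. \<bar>y $ k - x $ k\<bar>)" for z
  proof -
    have "\<bar>F z (y - x)\<bar> \<le> (\<Sum>k\<in>UNIV. \<bar>F z (axis k 1) * (y - x) $ k\<bar>)"
      by (subst linear_eq_sum_axis[OF has_derivative_linear[OF assms(1)]]) (rule sum_abs)
    also have "\<dots> \<le> (\<Sum>k\<in>UNIV. c * \<bar>y $ k - x $ k\<bar>)"
      using assms(2) by (intro sum_mono) (auto simp: abs_mult intro!: mult_right_mono)
    finally show ?thesis by (simp add: sum_distrib_left)
  qed
  then have "norm ((\<lambda>t. f (x + t *\<^sub>R (y - x))) 1 - (\<lambda>t. f (x + t *\<^sub>R (y - x))) 0)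
      \<le> c * (\<Sum>k\<in>UNIV. \<bar>y $ k - x $ k\<bar>) * norm (1 - 0 :: real)"
    by (intro field_differentiable_bound[where S=UNIV])
      (auto intro: has_real_derivative_along_line[OF assms(1)])
  then show ?thesis by simp
qed

text \<open>The iterated \<open>partial_deriv\<close> are identified with total derivatives
  evaluated on the axes, which makes the seminorms applicable; \<open>G m j\<close> is the
  \<open>j\<close>-th partial derivative of \<open>g m\<close>. The third derivative may be
  discontinuous, so its bound is passed on as a Lipschitz constant of the second partial
  derivatives.\<close>

lemma three_times_differentiable_bounds:
  fixes h :: "real^'n \<Rightarrow> real"
  assumes "three_times_differentiable h"
    and "deriv_norm1 h < \<infinity>" "deriv_norm2 h < \<infinity>" "deriv_norm3 h < \<infinity>"
  obtains g :: "'n \<Rightarrow> real^'n \<Rightarrow> real" and G :: "'n \<Rightarrow> 'n \<Rightarrow> real^'n \<Rightarrow> real" where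
    "\<And>x. (h has_derivative (\<lambda>v. \<Sum>m\<in>UNIV. g m x * v $ m)) (at x)"
    "\<And>m x. (g m has_derivative (\<lambda>v. \<Sum>j\<in>UNIV. G m j x * v $ j)) (at x)"
    "\<And>m x. \<bar>g m x\<bar> \<le> enn2real (deriv_norm1 h)"
    "\<And>m j x. \<bar>G m j x\<bar> \<le> enn2real (deriv_norm2 h)"
    "\<And>m j x y. \<bar>G m j y - G m j x\<bar> \<le> enn2real (deriv_norm3 h) * (\<Sum>k\<in>UNIV. \<bar>y $ k - x $ k\<bar>)"
proof -
  obtain D1 D2 D3 where D:
    "\<And>x. (h has_derivative blinfun_apply (D1 x)) (at x)"
    "\<And>x. (D1 has_derivative blinfun_apply (D2 x)) (at x)"
    "\<And>x. (D2 has_derivative blinfun_apply (D3 x)) (at x)"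
    using assms(1) unfolding three_times_differentiable_def by metis
  define g where "g m x = D1 x (axis m 1)" for m x
  define G where "G m j x = D2 x (axis j 1) (axis m 1)" for m j x
  have 1: "(g m has_derivative (\<lambda>v. D2 x v (axis m 1))) (at x)" for m x
    unfolding g_def by (rule bounded_linear.has_derivative[OF blinfun.bounded_linear_left D(2)])
  have 2: "(G m j has_derivative (\<lambda>v. D3 x v (axis j 1) (axis m 1))) (at x)" for m j x
    unfolding G_def
    by (rule bounded_linear.has_derivative[OF blinfun.bounded_linear_left],
        rule bounded_linear.has_derivative[OF blinfun.bounded_linear_left D(3)])
  have p1: "partial_deriv m h = g m" for m
    using partial_deriv_eq[OF D(1)] by (auto simp: g_def)
  have p2: "partial_deriv j (g m) = G m j" for m j
    using partial_deriv_eq[OF 1] by (auto simp: G_def)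
  have p3: "partial_deriv k (G m j) = (\<lambda>x. D3 x (axis k 1) (axis j 1) (axis m 1))" for k m j
    using partial_deriv_eq[OF 2] by auto
  show thesis
  proof
    show "(h has_derivative (\<lambda>v. \<Sum>m\<in>UNIV. g m x * v $ m)) (at x)" for x
      unfolding g_def by (rule has_derivative_sum_axis[OF D(1)])
    show "(g m has_derivative (\<lambda>v. \<Sum>j\<in>UNIV. G m j x * v $ j)) (at x)" for m x
      unfolding G_def by (rule has_derivative_sum_axis[OF 1])
    show "\<bar>g m x\<bar> \<le> enn2real (deriv_norm1 h)" for m x
      using assms(2) by (intro sup_norm_le_imp_abs_le) (auto simp: deriv_norm1_def p1 intro!: SUP_upper)
    show "\<bar>G m j x\<bar> \<le> enn2real (deriv_norm2 h)" for m j x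
    proof (rule sup_norm_le_imp_abs_le[OF _ assms(3)])
      show "sup_norm (G m j) \<le> deriv_norm2 h"
        unfolding deriv_norm2_def p1 p2
        by (rule SUP_upper2[OF UNIV_I[of j]], rule SUP_upper2[OF UNIV_I[of m]]) simp
    qed
    have "\<bar>D3 x (axis k 1) (axis j 1) (axis m 1)\<bar> \<le> enn2real (deriv_norm3 h)" for m j k x
    proof (rule sup_norm_le_imp_abs_le[OF _ assms(4), where f="\<lambda>x. D3 x (axis k 1) (axis j 1) (axis m 1)"])
      show "sup_norm (\<lambda>x. D3 x (axis k 1) (axis j 1) (axis m 1)) \<le> deriv_norm3 h"
        unfolding deriv_norm3_def p1 p2 p3
        by (rule SUP_upper2[OF UNIV_I[of k]], rule SUP_upper2[OF UNIV_I[of j]],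
            rule SUP_upper2[OF UNIV_I[of m]]) simp
    qed
    then show "\<bar>G m j y - G m j x\<bar> \<le> enn2real (deriv_norm3 h) * (\<Sum>k\<in>UNIV. \<bar>y $ k - x $ k\<bar>)" for m j x y
      by (intro abs_diff_le_of_partials[OF 2])
  qed
qed

text \<open>Along the segment, the function minus its linear part has a derivative of size at most
  \<open>c * E * t\<close>, by the Lipschitz bound on the partial derivatives. Comparing with
  \<open>c / 2 * E * t\<^sup>2\<close> gives the remainder without integrating a third
  derivative.\<close>

lemma taylor_remainder_le:
  fixes g :: "real^'n \<Rightarrow> real"
  assumes der: "\<And>x. (g has_derivative (\<lambda>v. \<Sum>j\<in>UNIV. G j x * v $ j)) (at x)"
    and lip: "\<And>j x y. \<bar>G j y - G j x\<bar> \<le> c * (\<Sum>k\<in>UNIV. \<bar>y $ k - x $ k\<bar>)"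
  shows "\<bar>g y - g x - (\<Sum>j\<in>UNIV. G j x * (y $ j - x $ j))\<bar>
    \<le> c / 2 * (\<Sum>j\<in>UNIV. \<Sum>k\<in>UNIV. \<bar>(y $ j - x $ j) * (y $ k - x $ k)\<bar>)"
proof -
  define d where "d = y - x"
  define E where "E = (\<Sum>j\<in>UNIV. \<Sum>k\<in>UNIV. \<bar>d $ j * d $ k\<bar>)"
  define p where "p t = g (x + t *\<^sub>R d) - t * (\<Sum>j\<in>UNIV. G j x * d $ j)" for t
  define p' where "p' t = (\<Sum>j\<in>UNIV. (G j (x + t *\<^sub>R d) - G j x) * d $ j)" for t
  have p: "(p has_vector_derivative p' t) (at t)" for t
    unfolding p_def p'_def has_real_derivative_iff_has_vector_derivative[symmetric]
    by (auto intro!: derivative_eq_intros has_real_derivative_along_line[OF der]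
        simp: sum_subtractf algebra_simps)
  have "norm (p 1 - p 0) \<le> (\<lambda>t. c / 2 * E * t\<^sup>2) 1 - (\<lambda>t. c / 2 * E * t\<^sup>2) 0"
  proof (rule differentiable_bound_general[where f'=p' and \<phi>'="\<lambda>t. c * E * t"])
    show "continuous_on {0..1} p"
      using p by (meson differentiableI_vector differentiable_imp_continuous_within
          continuous_at_imp_continuous_on)
    fix t :: real assume t: "0 < t" "t < 1"
    show "(p has_vector_derivative p' t) (at t)" by (rule p)
    show "((\<lambda>t. c / 2 * E * t\<^sup>2) has_vector_derivative c * E * t) (at t)"
      unfolding has_real_derivative_iff_has_vector_derivative[symmetric]
      by (auto intro!: derivative_eq_intros)
    have "norm (p' t) \<le> (\<Sum>j\<in>UNIV. \<bar>(G j (x + t *\<^sub>R d) - G j x) * d $ j\<bar>)"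
      unfolding p'_def real_norm_def by (rule sum_abs)
    also have "\<dots> \<le> (\<Sum>j\<in>UNIV. (c * (\<Sum>k\<in>UNIV. \<bar>(x + t *\<^sub>R d) $ k - x $ k\<bar>)) * \<bar>d $ j\<bar>)"
      unfolding abs_mult by (intro sum_mono mult_right_mono lip) auto
    also have "\<dots> = c * E * t"
      using t by (simp add: E_def abs_mult sum_distrib_left sum_distrib_right ac_simps)
    finally show "norm (p' t) \<le> c * E * t" .
  qed (auto intro!: continuous_intros)
  then show ?thesis by (simp add: p_def E_def d_def diff_diff_eq add.commute)
qed

lemma continuous_on_coordinate_lipschitz:
  fixes f :: "real^'n \<Rightarrow> real"
  assumes "\<And>x y. \<bar>f y - f x\<bar> \<le> c * (\<Sum>k\<in>UNIV. \<bar>y $ k - x $ k\<bar>)"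
  shows "continuous_on A f"
proof (rule continuous_at_imp_continuous_on, rule ballI)
  fix x
  have "((\<lambda>y. f y - f x) \<longlongrightarrow> 0) (at x)"
  proof (rule Lim_null_comparison)
    show "\<forall>\<^sub>F y in at x. norm (f y - f x) \<le> c * (\<Sum>k\<in>UNIV. \<bar>y $ k - x $ k\<bar>)"
      using assms by simp
    have "((\<lambda>y. c * (\<Sum>k\<in>UNIV. \<bar>y $ k - x $ k\<bar>)) \<longlongrightarrow> c * (\<Sum>k\<in>UNIV. \<bar>x $ k - x $ k\<bar>)) (at x)"
      by (intro tendsto_intros)
    then show "((\<lambda>y. c * (\<Sum>k\<in>UNIV. \<bar>y $ k - x $ k\<bar>)) \<longlongrightarrow> 0) (at x)" by simp
  qed
  then show "isCont f x" by (simp add: isCont_def LIM_zero_cancel)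
qed

subsection \<open>Gaussian integration by parts\<close>

lemma borel_measurable_vec_nth [measurable (raw)]:
  fixes f :: "'a \<Rightarrow> real^'n"
  assumes "f \<in> borel_measurable M"
  shows "(\<lambda>x. f x $ k) \<in> borel_measurable M"
  by (rule measurable_compose[OF assms borel_measurable_continuous_onI]) (intro continuous_intros)

text \<open>Both integrals below are those of \<open>u' (z + t v)\<close> over \<open>t\<close> in \<open>[0, 1]\<close> and all \<open>z\<close>:
  integrating over \<open>t\<close> first gives \<open>u (z + v) - u z\<close>, whose integral vanishes by translation
  invariance.\<close>

lemma integral_directional_derivative_eq_0:
  fixes u u' :: "'a::euclidean_space \<Rightarrow> real"
  assumes der: "\<And>z t. ((\<lambda>t. u (z + t *\<^sub>R v)) has_real_derivative u' (z + t *\<^sub>R v)) (at t)"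
    and cont: "continuous_on UNIV u'"
    and u: "integrable lborel u" and u': "integrable lborel u'"
  shows "integral\<^sup>L lborel u' = 0"
proof -
  have [measurable]: "u' \<in> borel_measurable borel"
    using cont by (rule borel_measurable_continuous_onI)
  have [measurable]: "u \<in> borel_measurable borel"
    using u by auto
  have shift_int: "integrable lborel (\<lambda>z. f (z + c))"
    and shift: "(\<integral>z. f (z + c) \<partial>lborel) = integral\<^sup>L lborel f"
    if "integrable lborel f" for f :: "'a \<Rightarrow> real" and c
  proof -
    have [measurable]: "f \<in> borel_measurable borel" using that by auto
    show "integrable lborel (\<lambda>z. f (z + c))"
      using that by (subst (asm) lborel_distr_plus[of c, symmetric]) (simp add: integrable_distr_eq add.commute)
    show "(\<integral>z. f (z + c) \<partial>lborel) = integral\<^sup>L lborel f"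
      by (subst (2) lborel_distr_plus[of c, symmetric]) (simp add: integral_distr add.commute)
  qed
  define \<Phi> where "\<Phi> t z = indicator {0..1} t * u' (z + t *\<^sub>R v)" for t :: real and z
  have "integrable (lborel \<Otimes>\<^sub>M lborel) (case_prod \<Phi>)"
  proof (rule lborel_pair.Fubini_integrable)
    show "case_prod \<Phi> \<in> borel_measurable (lborel \<Otimes>\<^sub>M lborel)"
      unfolding \<Phi>_def by measurable
    \<comment> \<open>By translation invariance the inner integral depends on t only through the
      indicator, hence is integrable in t.\<close>
    have "(\<integral>z. norm (case_prod \<Phi> (t, z)) \<partial>lborel) = indicator {0..1} t * (\<integral>z. \<bar>u' z\<bar> \<partial>lborel)" for t
      using shift[of "\<lambda>z. \<bar>u' z\<bar>" "t *\<^sub>R v"] u' by (simp add: \<Phi>_def abs_mult)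
    then show "integrable lborel (\<lambda>t. \<integral>z. norm (case_prod \<Phi> (t, z)) \<partial>lborel)"
      by (simp add: integrable_mult_left_iff)
    show "AE t in lborel. integrable lborel (\<lambda>z. case_prod \<Phi> (t, z))"
      using shift_int[OF u'] by (simp add: \<Phi>_def)
  qed
  then have "(\<integral>z. (\<integral>t. \<Phi> t z \<partial>lborel) \<partial>lborel) = (\<integral>t. (\<integral>z. \<Phi> t z \<partial>lborel) \<partial>lborel)"
    by (rule lborel_pair.Fubini_integral)
  moreover have "(\<integral>t. \<Phi> t z \<partial>lborel) = u (z + v) - u z" for z
  proof -
    have "(\<integral>t. u' (z + t *\<^sub>R v) * indicator {0..1} t \<partial>lborel) = u (z + 1 *\<^sub>R v) - u (z + 0 *\<^sub>R v)"
      using der continuous_on_compose2[OF cont, of UNIV "\<lambda>t. z + t *\<^sub>R v"]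
      by (intro integral_FTC_Icc_real) (auto simp: continuous_on_eq_continuous_at intro!: continuous_intros)
    then show ?thesis by (simp add: \<Phi>_def mult.commute)
  qed
  moreover have "(\<integral>t. (\<integral>z. \<Phi> t z \<partial>lborel) \<partial>lborel) = integral\<^sup>L lborel u'"
    using shift[OF u'] by (simp add: \<Phi>_def)
  ultimately show ?thesis using shift[OF u, of v] shift_int[OF u, of v] u by simp
qed

section \<open>The standard Gaussian density and its first moments\<close>

lemma has_real_derivative_std_normal_density:
  "(std_normal_density has_real_derivative - x * std_normal_density x) (at x)"
proof -
  have eq: "std_normal_density = (\<lambda>x. 1 / sqrt (2 * pi) * exp (- x\<^sup>2 / 2))"
    by (simp add: std_normal_density_def fun_eq_iff)
  show ?thesis
    unfolding eq by (auto intro!: derivative_eq_intros simp: field_simps)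
qed

definition std_normal_density_vec :: "real^'n \<Rightarrow> real" where
  "std_normal_density_vec z = (\<Prod>i\<in>UNIV. std_normal_density (z $ i))"

lemma std_normal_density_vec_nonneg: "0 \<le> std_normal_density_vec z"
  by (simp add: std_normal_density_vec_def prod_nonneg)

lemma continuous_on_std_normal_density_vec: "continuous_on S std_normal_density_vec"
  unfolding std_normal_density_vec_def std_normal_density_def
  by (intro continuous_intros) auto

lemma std_normal_density_vec_measurable [measurable]:
  "std_normal_density_vec \<in> borel_measurable borel"
  by (rule borel_measurable_continuous_onI[OF continuous_on_std_normal_density_vec])

lemma has_real_derivative_std_normal_density_vec:
  fixes z :: "real^'n"
  shows "((\<lambda>t. std_normal_density_vec (z + t *\<^sub>R axis k 1)) has_real_derivative
    - (z + t *\<^sub>R axis k 1) $ k * std_normal_density_vec (z + t *\<^sub>R axis k 1)) (at t)"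
proof -
  \<comment> \<open>Along the \<open>k\<close>-th axis only the \<open>k\<close>-th factor of the
    product moves.\<close>
  have eq: "std_normal_density_vec (z + t *\<^sub>R axis k 1)
      = std_normal_density (z $ k + t) * (\<Prod>i\<in>UNIV - {k}. std_normal_density (z $ i))" for t
    unfolding std_normal_density_vec_def
    by (subst prod.remove[of _ k]) (auto intro!: prod.cong simp: axis_def)
  have "((\<lambda>t. std_normal_density (z $ k + t)) has_real_derivative
      - (z $ k + t) * std_normal_density (z $ k + t)) (at t)"
    using DERIV_chain2[OF has_real_derivative_std_normal_density, of "\<lambda>t. z $ k + t" 1 t UNIV]
      DERIV_add[OF DERIV_const DERIV_ident, of "z $ k" t UNIV] by simp
  from DERIV_cmult_right[OF this, of "\<Prod>i\<in>UNIV - {k}. std_normal_density (z $ i)"]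
  show ?thesis unfolding eq by (simp add: mult.assoc)
qed

lemma standard_normal_vector_integrable_component:
  fixes Z :: "'b \<Rightarrow> real^'n"
  assumes "standard_normal_vector N Z"
  shows "integrable N (\<lambda>\<omega>. Z \<omega> $ k)"
proof -
  have D: "distributed N lborel Z std_normal_density_vec"
    using assms by (simp add: standard_normal_vector_def std_normal_density_vec_def)
  \<comment> \<open>Moving the absolute value of the \<open>k\<close>-th coordinate into the
    \<open>k\<close>-th factor keeps the integrand a product, so its integral splits into
    one-dimensional Gaussian moments of order 0 or 1. The factors are indexed by basis vectors to
    match \<open>nn_integral_lborel_prod\<close>.\<close>
  define w :: "real^'n \<Rightarrow> real \<Rightarrow> real"
    where "w b x = (if b = axis k 1 then \<bar>x\<bar> else 1) * std_normal_density x" for b x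
  have Basis: "(\<Prod>b\<in>Basis. q b) = (\<Prod>i\<in>UNIV. q (axis i 1))" for q :: "real^'n \<Rightarrow> 'c::comm_monoid_mult"
  proof -
    have "(Basis :: (real^'n) set) = range (\<lambda>i. axis i 1)" by (auto simp: Basis_vec_def)
    moreover have "inj (\<lambda>i::'n. axis i (1::real))" by (auto simp: inj_def axis_eq_axis)
    ultimately show ?thesis by (metis prod.reindex_cong)
  qed
  have w: "(\<Prod>b\<in>Basis. w b (z \<bullet> b)) = std_normal_density_vec z * \<bar>z $ k\<bar>" for z
  proof -
    have "(\<Prod>b\<in>Basis. w b (z \<bullet> b)) = (\<Prod>i\<in>UNIV. (if i = k then \<bar>z $ i\<bar> else 1) * std_normal_density (z $ i))"
      unfolding Basis by (intro prod.cong) (auto simp: w_def inner_axis axis_eq_axis)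
    also have "\<dots> = \<bar>z $ k\<bar> * std_normal_density_vec z"
      unfolding prod.distrib std_normal_density_vec_def by (simp add: prod.delta)
    finally show ?thesis by simp
  qed
  have "(\<integral>\<^sup>+z. ennreal (std_normal_density_vec z * \<bar>z $ k\<bar>) \<partial>lborel)
      = (\<integral>\<^sup>+z. (\<Prod>b\<in>Basis. ennreal (w b (z \<bullet> b))) \<partial>lborel)"
    unfolding w[symmetric] by (intro nn_integral_cong prod_ennreal[symmetric]) (simp add: w_def)
  also have "\<dots> = (\<Prod>b\<in>Basis. (\<integral>\<^sup>+x. ennreal (w b x) \<partial>lborel))"
    by (rule nn_integral_lborel_prod) (auto simp: w_def)
  also have "\<dots> < \<infinity>"
  proof -
    have "integrable lborel (w b)" for b
      unfolding w_def
      using integrable_std_normal_moment_abs[of 1] integrable_normal_density[of 1 0]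
      by (cases "b = axis k 1") (auto simp: mult.commute)
    then have "(\<integral>\<^sup>+x. ennreal (w b x) \<partial>lborel) < \<infinity>" for b
      by (subst nn_integral_eq_integral) (auto simp: w_def)
    then show ?thesis unfolding infinity_ennreal_def less_top[symmetric] by (auto simp: ennreal_prod_eq_top)
  qed
  finally have "integrable lborel (\<lambda>z. std_normal_density_vec z * z $ k)"
    by (intro integrableI_bounded) (auto simp: abs_mult std_normal_density_vec_nonneg)
  then show ?thesis
    by (subst (asm) distributed_integrable[OF D]) (auto simp: std_normal_density_vec_nonneg)
qed

text \<open>The derivative of \<open>f z * std_normal_density_vec z\<close> along the
  \<open>k\<close>-th axis is
  \<open>(F z (axis k 1) - z $ k * f z) * std_normal_density_vec z\<close>. Its Lebesgue integral
  vanishes, and read as an expectation under the law of \<open>Z\<close> this is the claim. The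
  bounds on \<open>f\<close> and its partial derivative provide integrability.\<close>

lemma std_normal_vector_integration_by_parts:
  fixes f :: "real^'n \<Rightarrow> real" and Z :: "'b \<Rightarrow> real^'n"
  assumes "prob_space N" and Z: "standard_normal_vector N Z"
    and der: "\<And>x. (f has_derivative F x) (at x)"
    and cont: "continuous_on UNIV (\<lambda>x. F x (axis k 1))"
    and f: "\<And>x. \<bar>f x\<bar> \<le> a" and F: "\<And>x. \<bar>F x (axis k 1)\<bar> \<le> b"
  shows "(\<integral>\<omega>. Z \<omega> $ k * f (Z \<omega>) \<partial>N) = (\<integral>\<omega>. F (Z \<omega>) (axis k 1) \<partial>N)"
proof -
  interpret prob_space N by fact
  have D: "distributed N lborel Z std_normal_density_vec"
    using Z by (simp add: standard_normal_vector_def std_normal_density_vec_def)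
  have [measurable]: "Z \<in> N \<rightarrow>\<^sub>M borel" using distributed_measurable[OF D] by simp
  have contf: "continuous_on UNIV f"
    using der by (meson differentiableI differentiable_imp_continuous_on differentiable_at_imp_differentiable_on)
  have [measurable]: "f \<in> borel_measurable borel" "(\<lambda>x. F x (axis k 1)) \<in> borel_measurable borel"
    using contf cont by (auto intro: borel_measurable_continuous_onI)
  have Zf: "integrable N (\<lambda>\<omega>. Z \<omega> $ k * f (Z \<omega>))"
    by (rule Bochner_Integration.integrable_bound[OF integrable_mult_right[OF
          standard_normal_vector_integrable_component[OF Z, of k], of a]])
      (auto simp: abs_mult mult.commute intro!: mult_right_mono order.trans[OF f])
  have FZ: "integrable N (\<lambda>\<omega>. F (Z \<omega>) (axis k 1))"
    by (rule integrable_const_bound[where B=b]) (auto simp: F)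
  have fZ: "integrable N (\<lambda>\<omega>. f (Z \<omega>))"
    by (rule integrable_const_bound[where B=a]) (auto simp: f)
  note nn = std_normal_density_vec_nonneg
  define u' where "u' z = F z (axis k 1) * std_normal_density_vec z - z $ k * f z * std_normal_density_vec z" for z
  have "integral\<^sup>L lborel u' = 0"
  proof (rule integral_directional_derivative_eq_0)
    show "((\<lambda>t. f (z + t *\<^sub>R axis k 1) * std_normal_density_vec (z + t *\<^sub>R axis k 1))
        has_real_derivative u' (z + t *\<^sub>R axis k 1)) (at t)" for z t
      using DERIV_mult[OF has_real_derivative_along_line[OF der, of z "axis k 1" t]
          has_real_derivative_std_normal_density_vec[of z k t]]
      by (simp add: u'_def algebra_simps)
    show "continuous_on UNIV u'"
      unfolding u'_def
      by (intro continuous_intros cont contf continuous_on_std_normal_density_vec)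
    show "integrable lborel (\<lambda>z. f z * std_normal_density_vec z)"
      using distributed_integrable[OF D, of f] fZ by (simp add: nn mult.commute)
    show "integrable lborel u'"
      unfolding u'_def
      using distributed_integrable[OF D, of "\<lambda>z. z $ k * f z"] Zf
        distributed_integrable[OF D, of "\<lambda>z. F z (axis k 1)"] FZ
      by (intro Bochner_Integration.integrable_diff) (simp_all add: nn ac_simps)
  qed
  moreover have "integral\<^sup>L lborel u' = (\<integral>\<omega>. F (Z \<omega>) (axis k 1) \<partial>N) - (\<integral>\<omega>. Z \<omega> $ k * f (Z \<omega>) \<partial>N)"
    using distributed_integrable[OF D, of "\<lambda>z. z $ k * f z"] Zf
        distributed_integrable[OF D, of "\<lambda>z. F z (axis k 1)"] FZ
        distributed_integral[OF D, of "\<lambda>z. z $ k * f z"]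
        distributed_integral[OF D, of "\<lambda>z. F z (axis k 1)"]
    unfolding u'_def by (subst Bochner_Integration.integral_diff) (simp_all add: nn ac_simps)
  ultimately show ?thesis by simp
qed

subsection \<open>Second moments and variance\<close>

lemma integrable_mult_of_squares:
  fixes X Y :: "'a \<Rightarrow> real"
  assumes [measurable]: "X \<in> borel_measurable M" "Y \<in> borel_measurable M"
    and "integrable M (\<lambda>\<omega>. (X \<omega>)\<^sup>2)" "integrable M (\<lambda>\<omega>. (Y \<omega>)\<^sup>2)"
  shows "integrable M (\<lambda>\<omega>. X \<omega> * Y \<omega>)"
proof (rule Bochner_Integration.integrable_bound)
  show "integrable M (\<lambda>\<omega>. (X \<omega>)\<^sup>2 + (Y \<omega>)\<^sup>2)" using assms by simp
  have "\<bar>x * y\<bar> \<le> x\<^sup>2 + y\<^sup>2" for x y :: real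
    using sum_squares_bound[of "\<bar>x\<bar>" "\<bar>y\<bar>"] mult_nonneg_nonneg[of "\<bar>x\<bar>" "\<bar>y\<bar>"]
    unfolding abs_mult power2_abs by linarith
  then show "AE \<omega> in M. norm (X \<omega> * Y \<omega>) \<le> norm ((X \<omega>)\<^sup>2 + (Y \<omega>)\<^sup>2)"
    by (auto intro: order.trans[OF _ abs_ge_self])
qed simp

lemma abs_integral_mult_le:
  fixes X Y :: "'a \<Rightarrow> real"
  assumes [measurable]: "X \<in> borel_measurable M" "Y \<in> borel_measurable M"
    and X: "integrable M (\<lambda>\<omega>. (X \<omega>)\<^sup>2)" and Y: "integrable M (\<lambda>\<omega>. (Y \<omega>)\<^sup>2)"
  shows "\<bar>\<integral>\<omega>. X \<omega> * Y \<omega> \<partial>M\<bar> \<le> sqrt (\<integral>\<omega>. (X \<omega>)\<^sup>2 \<partial>M) * sqrt (\<integral>\<omega>. (Y \<omega>)\<^sup>2 \<partial>M)"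
proof -
  note XY = integrable_mult_of_squares[OF assms]
  define x y m where "x = (\<integral>\<omega>. (X \<omega>)\<^sup>2 \<partial>M)" and "y = (\<integral>\<omega>. (Y \<omega>)\<^sup>2 \<partial>M)"
    and "m = (\<integral>\<omega>. X \<omega> * Y \<omega> \<partial>M)"
  have xy: "0 \<le> x" "0 \<le> y" by (simp_all add: x_def y_def)
  have q: "0 \<le> s\<^sup>2 * x + 2 * s * t * m + t\<^sup>2 * y" for s t
  proof -
    have "0 \<le> (\<integral>\<omega>. (s * X \<omega> + t * Y \<omega>)\<^sup>2 \<partial>M)" by simp
    also have "\<dots> = (\<integral>\<omega>. s\<^sup>2 * (X \<omega>)\<^sup>2 + 2 * s * t * (X \<omega> * Y \<omega>) + t\<^sup>2 * (Y \<omega>)\<^sup>2 \<partial>M)"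
      by (intro Bochner_Integration.integral_cong) (auto simp: power2_eq_square algebra_simps)
    also have "\<dots> = s\<^sup>2 * x + 2 * s * t * m + t\<^sup>2 * y"
      using X Y XY by (simp add: x_def y_def m_def)
    finally show ?thesis .
  qed
  \<comment> \<open>The quadratic form in (s, t) is nonnegative, so its discriminant has the right
    sign: s = y, t = - m gives y (x y - m^2) \<ge> 0. If y = 0, taking s = m and t = - (x/2 + 1)
    forces m = 0.\<close>
  have "m\<^sup>2 \<le> x * y"
  proof (cases "y = 0")
    case True
    have "0 \<le> m\<^sup>2 * x - 2 * m\<^sup>2 * n" for n
      using q[of m "- n"] True by (simp add: power2_eq_square algebra_simps)
    from this[of "x / 2 + 1"] have "m\<^sup>2 \<le> 0" by (simp add: algebra_simps)
    then show ?thesis using xy by (simp add: True)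
  next
    case False
    have "0 \<le> y * (x * y - m\<^sup>2)" using q[of y "- m"] by (simp add: power2_eq_square algebra_simps)
    then show ?thesis using False xy by (simp add: zero_le_mult_iff)
  qed
  then have "\<bar>m\<bar> \<le> sqrt (x * y)" by (metis real_sqrt_abs real_sqrt_le_mono)
  then show ?thesis by (simp add: real_sqrt_mult x_def y_def m_def)
qed

lemma integrable_mult_bounded:
  fixes f g :: "'a \<Rightarrow> real"
  assumes "integrable M f" "g \<in> borel_measurable M" "\<And>\<omega>. \<bar>g \<omega>\<bar> \<le> b"
  shows "integrable M (\<lambda>\<omega>. f \<omega> * g \<omega>)"
proof (rule Bochner_Integration.integrable_bound)
  show "integrable M (\<lambda>\<omega>. f \<omega> * b)" using assms by simp
  show "AE \<omega> in M. norm (f \<omega> * g \<omega>) \<le> norm (f \<omega> * b)"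
    using assms(3) by (auto simp: abs_mult intro!: mult_left_mono order.trans[OF assms(3)])
qed (use assms in measurable)

text \<open>Since \<open>enn2real \<infinity> = 0\<close>, this is a genuine standard deviation only
  where \<open>evariance\<close> is finite; the lemmas that evaluate or bound with it assume that
  finiteness.\<close>

abbreviation std_dev :: "'a measure \<Rightarrow> ('a \<Rightarrow> real) \<Rightarrow> real" where
  "std_dev M X \<equiv> enn2real (ennreal_sqrt (evariance M X))"

lemma evariance_finite:
  assumes [measurable]: "X \<in> borel_measurable M" and "evariance M X < \<infinity>"
  shows "integrable M (\<lambda>\<omega>. (X \<omega> - integral\<^sup>L M X)\<^sup>2)"
    and "std_dev M X = sqrt (\<integral>\<omega>. (X \<omega> - integral\<^sup>L M X)\<^sup>2 \<partial>M)"
proof -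
  show "integrable M (\<lambda>\<omega>. (X \<omega> - integral\<^sup>L M X)\<^sup>2)"
    using assms(2) by (intro integrableI_bounded) (auto simp: evariance_def)
  have "(\<integral>\<omega>. (X \<omega> - integral\<^sup>L M X)\<^sup>2 \<partial>M) = enn2real (evariance M X)"
    unfolding evariance_def by (rule integral_eq_nn_integral) auto
  then show "std_dev M X = sqrt (\<integral>\<omega>. (X \<omega> - integral\<^sup>L M X)\<^sup>2 \<partial>M)"
    using assms(2) by (auto simp: ennreal_sqrt_def enn2real_nonneg)
qed

text \<open>Cauchy-Schwarz applied to the centred \<open>X\<close>, so that only its variance
  enters. The number \<open>c\<close> will be the square of a supremum bound, or the largest entry
  of the covariance matrix.\<close>

lemma abs_integral_centred_mult_le:
  assumes [measurable]: "X \<in> borel_measurable M" "Y \<in> borel_measurable M"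
    and X: "evariance M X < \<infinity>" and Y: "integrable M (\<lambda>\<omega>. (Y \<omega>)\<^sup>2)" and c: "(\<integral>\<omega>. (Y \<omega>)\<^sup>2 \<partial>M) \<le> c"
  shows "integrable M (\<lambda>\<omega>. (X \<omega> - integral\<^sup>L M X) * Y \<omega>)"
    and "\<bar>\<integral>\<omega>. (X \<omega> - integral\<^sup>L M X) * Y \<omega> \<partial>M\<bar> \<le> sqrt c * std_dev M X"
proof -
  show "integrable M (\<lambda>\<omega>. (X \<omega> - integral\<^sup>L M X) * Y \<omega>)"
    using evariance_finite[OF assms(1) X] Y by (intro integrable_mult_of_squares) auto
  have "\<bar>\<integral>\<omega>. (X \<omega> - integral\<^sup>L M X) * Y \<omega> \<partial>M\<bar>
      \<le> std_dev M X * sqrt (\<integral>\<omega>. (Y \<omega>)\<^sup>2 \<partial>M)"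
    unfolding evariance_finite(2)[OF assms(1) X]
    using evariance_finite[OF assms(1) X] Y by (intro abs_integral_mult_le) auto
  also have "\<dots> \<le> std_dev M X * sqrt c"
    using c by (intro mult_left_mono) auto
  finally show "\<bar>\<integral>\<omega>. (X \<omega> - integral\<^sup>L M X) * Y \<omega> \<partial>M\<bar> \<le> sqrt c * std_dev M X"
    by (simp add: mult.commute)
qed

lemma ennreal_sqrt_finite_iff: "ennreal_sqrt v < \<infinity> \<longleftrightarrow> v < \<infinity>"
  by (auto simp: ennreal_sqrt_def less_top)

subsection \<open>The exchangeable pair\<close>

locale exchangeable_regression = prob_space M for M :: "'a measure" +
  fixes W W' R :: "'a \<Rightarrow> real^'n" and S L :: "real^'n^'n"
  assumes exch: "exchangeable_pair M W W'"
    and mean_W: "has_bochner_integral M W 0"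
    and cov_W: "has_bochner_integral M (\<lambda>\<omega>. \<chi> i j. W \<omega> $ i * W \<omega> $ j) S"
    and inv_L: "invertible L"
    and R_sigma_W: "R \<in> borel_measurable (sigma_gen M W)"
    and regression: "AE \<omega> in M. \<forall>i. cond_exp_given M W (\<lambda>\<omega>'. W' \<omega>' $ i - W \<omega>' $ i) \<omega> = (- (L *v W \<omega>) + R \<omega>) $ i"
begin

lemma W_measurable [measurable]: "W \<in> borel_measurable M" and W'_measurable [measurable]: "W' \<in> borel_measurable M"
  using exch by (auto simp: exchangeable_pair_def)

lemma measurable_sigma_gen: "f \<in> borel_measurable borel \<Longrightarrow> (\<lambda>\<omega>. f (W \<omega>)) \<in> borel_measurable (sigma_gen M W)"
  unfolding sigma_gen_def by (rule measurable_compose[OF measurable_vimage_algebra1]) auto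

lemma subalgebra_sigma_gen: "subalgebra M (sigma_gen M W)"
  unfolding subalgebra_def sigma_gen_def
  using W_measurable by (auto simp: sets_vimage_algebra2 measurable_sets)

lemma R_measurable [measurable]: "R \<in> borel_measurable M"
  using measurable_from_subalg[OF subalgebra_sigma_gen R_sigma_W] .

sublocale finite_measure_subalgebra M "sigma_gen M W"
  by unfold_locales (rule subalgebra_sigma_gen)

lemma integrable_W: "integrable M (\<lambda>\<omega>. W \<omega> $ k)" and integral_W: "(\<integral>\<omega>. W \<omega> $ k \<partial>M) = 0"
  using has_bochner_integral_bounded_linear[OF bounded_linear_vec_nth mean_W, of k]
  by (auto simp: has_bochner_integral_iff)

lemma integrable_W_W: "integrable M (\<lambda>\<omega>. W \<omega> $ i * W \<omega> $ j)"
  and integral_W_W: "(\<integral>\<omega>. W \<omega> $ i * W \<omega> $ j \<partial>M) = S $ i $ j"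
  using has_bochner_integral_bounded_linear[OF bounded_linear_vec_nth
      has_bochner_integral_bounded_linear[OF bounded_linear_vec_nth cov_W, of i], of j]
  by (auto simp: has_bochner_integral_iff)

lemma
  fixes f :: "(real^'n) \<times> (real^'n) \<Rightarrow> real"
  assumes [measurable]: "f \<in> borel_measurable (borel \<Otimes>\<^sub>M borel)"
  shows integrable_swap: "integrable M (\<lambda>\<omega>. f (W' \<omega>, W \<omega>)) \<longleftrightarrow> integrable M (\<lambda>\<omega>. f (W \<omega>, W' \<omega>))"
    and integral_swap: "(\<integral>\<omega>. f (W' \<omega>, W \<omega>) \<partial>M) = (\<integral>\<omega>. f (W \<omega>, W' \<omega>) \<partial>M)"
proof -
  have eq: "distr M (borel \<Otimes>\<^sub>M borel) (\<lambda>\<omega>. (W \<omega>, W' \<omega>)) = distr M (borel \<Otimes>\<^sub>M borel) (\<lambda>\<omega>. (W' \<omega>, W \<omega>))"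
    using exch by (simp add: exchangeable_pair_def)
  have "integrable (distr M (borel \<Otimes>\<^sub>M borel) (\<lambda>\<omega>. (W' \<omega>, W \<omega>))) f \<longleftrightarrow> integrable M (\<lambda>\<omega>. f (W' \<omega>, W \<omega>))"
    by (rule integrable_distr_eq) auto
  moreover have "integrable (distr M (borel \<Otimes>\<^sub>M borel) (\<lambda>\<omega>. (W \<omega>, W' \<omega>))) f \<longleftrightarrow> integrable M (\<lambda>\<omega>. f (W \<omega>, W' \<omega>))"
    by (rule integrable_distr_eq) auto
  ultimately show "integrable M (\<lambda>\<omega>. f (W' \<omega>, W \<omega>)) \<longleftrightarrow> integrable M (\<lambda>\<omega>. f (W \<omega>, W' \<omega>))"
    unfolding eq by blast
  have "integral\<^sup>L (distr M (borel \<Otimes>\<^sub>M borel) (\<lambda>\<omega>. (W' \<omega>, W \<omega>))) f = (\<integral>\<omega>. f (W' \<omega>, W \<omega>) \<partial>M)"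
    by (rule integral_distr) auto
  moreover have "integral\<^sup>L (distr M (borel \<Otimes>\<^sub>M borel) (\<lambda>\<omega>. (W \<omega>, W' \<omega>))) f = (\<integral>\<omega>. f (W \<omega>, W' \<omega>) \<partial>M)"
    by (rule integral_distr) auto
  ultimately show "(\<integral>\<omega>. f (W' \<omega>, W \<omega>) \<partial>M) = (\<integral>\<omega>. f (W \<omega>, W' \<omega>) \<partial>M)"
    unfolding eq by metis
qed

section \<open>Increments of the pair and their moments\<close>

definition D :: "'n \<Rightarrow> 'a \<Rightarrow> real" where
  "D i \<omega> = W' \<omega> $ i - W \<omega> $ i"

lemma D_measurable [measurable]: "D i \<in> borel_measurable M"
  unfolding D_def by measurable

lemma square_integrable_W: "integrable M (\<lambda>\<omega>. (W \<omega> $ k)\<^sup>2)"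
  using integrable_W_W[of k k] by (simp add: power2_eq_square)

lemma square_integrable_W': "integrable M (\<lambda>\<omega>. (W' \<omega> $ k)\<^sup>2)"
  using integrable_swap[of "\<lambda>p. (fst p $ k)\<^sup>2"] square_integrable_W[of k] by simp

lemma square_integrable_D: "integrable M (\<lambda>\<omega>. (D i \<omega>)\<^sup>2)"
proof -
  have "(D i \<omega>)\<^sup>2 = (W' \<omega> $ i)\<^sup>2 - 2 * (W' \<omega> $ i * W \<omega> $ i) + (W \<omega> $ i)\<^sup>2" for \<omega>
    by (simp add: D_def power2_eq_square algebra_simps)
  then show ?thesis
    using square_integrable_W square_integrable_W' integrable_mult_of_squares[of "\<lambda>\<omega>. W' \<omega> $ i" M "\<lambda>\<omega>. W \<omega> $ i"]
    by simp
qed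

lemma integrable_D_D: "integrable M (\<lambda>\<omega>. D i \<omega> * D j \<omega>)"
  by (intro integrable_mult_of_squares square_integrable_D) auto

lemma integrable_D_f:
  assumes [measurable]: "f \<in> borel_measurable borel" and "integrable M (\<lambda>\<omega>. (f (W \<omega>))\<^sup>2)"
  shows "integrable M (\<lambda>\<omega>. D i \<omega> * f (W \<omega>))"
  using assms(2) by (intro integrable_mult_of_squares square_integrable_D) auto

text \<open>Exchanging \<open>W\<close> and \<open>W'\<close> in
  \<open>D i \<omega> * f (W \<omega>)\<close> flips the sign of the increment and moves
  \<open>f\<close> to \<open>W'\<close>, while exchangeability keeps the expectation. Square
  integrability of \<open>f (W \<omega>)\<close> is assumed rather than boundedness, so that
  \<open>f\<close> may also be a coordinate function.\<close>

lemma antisymmetry: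
  assumes [measurable]: "f \<in> borel_measurable borel" and int: "integrable M (\<lambda>\<omega>. (f (W \<omega>))\<^sup>2)"
  shows "integrable M (\<lambda>\<omega>. D i \<omega> * f (W' \<omega>))"
    and "(\<integral>\<omega>. D i \<omega> * (f (W' \<omega>) - f (W \<omega>)) \<partial>M) = - 2 * (\<integral>\<omega>. D i \<omega> * f (W \<omega>) \<partial>M)"
proof -
  note sw = integrable_swap[of "\<lambda>q. (snd q $ i - fst q $ i) * f (fst q)"]
    integral_swap[of "\<lambda>q. (snd q $ i - fst q $ i) * f (fst q)"]
  have neg: "D i \<omega> * f (W' \<omega>) = - ((W \<omega> $ i - W' \<omega> $ i) * f (W' \<omega>))" for \<omega>
    by (simp add: D_def algebra_simps)
  show int': "integrable M (\<lambda>\<omega>. D i \<omega> * f (W' \<omega>))"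
    using sw(1) integrable_D_f[OF assms, of i] unfolding neg by (simp add: D_def)
  have "(\<integral>\<omega>. D i \<omega> * f (W' \<omega>) \<partial>M) = - (\<integral>\<omega>. D i \<omega> * f (W \<omega>) \<partial>M)"
    using sw(2) unfolding neg by (simp add: D_def)
  then show "(\<integral>\<omega>. D i \<omega> * (f (W' \<omega>) - f (W \<omega>)) \<partial>M) = - 2 * (\<integral>\<omega>. D i \<omega> * f (W \<omega>) \<partial>M)"
    using int' integrable_D_f[OF assms, of i] by (simp add: right_diff_distrib)
qed

text \<open>As \<open>f (W \<omega>)\<close> is measurable with respect to the \<sigma>-algebra of
  \<open>W\<close>, it can be pulled out of the conditional expectation, which the regression
  property then evaluates. Integrability of the term with \<open>R\<close> is a conclusion: it is
  what remains of an integrable product after the integrable terms with \<open>W\<close> are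
  removed.\<close>

lemma
  assumes [measurable]: "f \<in> borel_measurable borel" and int: "integrable M (\<lambda>\<omega>. (f (W \<omega>))\<^sup>2)"
  shows integrable_R_f: "integrable M (\<lambda>\<omega>. R \<omega> $ i * f (W \<omega>))"
    and integral_D_f: "(\<integral>\<omega>. D i \<omega> * f (W \<omega>) \<partial>M)
      = (\<integral>\<omega>. R \<omega> $ i * f (W \<omega>) \<partial>M) - (\<Sum>k\<in>UNIV. L $ i $ k * (\<integral>\<omega>. W \<omega> $ k * f (W \<omega>) \<partial>M))"
proof -
  have Wf: "integrable M (\<lambda>\<omega>. W \<omega> $ k * f (W \<omega>))" for k
    using int by (intro integrable_mult_of_squares square_integrable_W) auto
  have fD: "integrable M (\<lambda>\<omega>. f (W \<omega>) * D i \<omega>)"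
    using integrable_D_f[OF assms] by (simp add: mult.commute)
  note ce = real_cond_exp_intg[OF fD measurable_sigma_gen D_measurable, OF assms(1)]
  have ae: "AE \<omega> in M. f (W \<omega>) * real_cond_exp M (sigma_gen M W) (D i) \<omega>
      = R \<omega> $ i * f (W \<omega>) - (\<Sum>k\<in>UNIV. L $ i $ k * (W \<omega> $ k * f (W \<omega>)))"
    using regression
  proof eventually_elim
    case (elim \<omega>)
    have "real_cond_exp M (sigma_gen M W) (D i) \<omega> = R \<omega> $ i - (\<Sum>k\<in>UNIV. L $ i $ k * W \<omega> $ k)"
      using elim by (simp add: cond_exp_given_def D_def[abs_def] matrix_vector_mult_def)
    then show ?case by (simp add: right_diff_distrib sum_distrib_left ac_simps)
  qed
  have "integrable M (\<lambda>\<omega>. R \<omega> $ i * f (W \<omega>) - (\<Sum>k\<in>UNIV. L $ i $ k * (W \<omega> $ k * f (W \<omega>))))"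
    using ce(1) by (subst integrable_cong_AE[OF _ _ ae, symmetric]) auto
  from Bochner_Integration.integrable_add[OF this, of "\<lambda>\<omega>. \<Sum>k\<in>UNIV. L $ i $ k * (W \<omega> $ k * f (W \<omega>))"]
  show Rf: "integrable M (\<lambda>\<omega>. R \<omega> $ i * f (W \<omega>))" using Wf by simp
  have "(\<integral>\<omega>. D i \<omega> * f (W \<omega>) \<partial>M)
      = (\<integral>\<omega>. R \<omega> $ i * f (W \<omega>) - (\<Sum>k\<in>UNIV. L $ i $ k * (W \<omega> $ k * f (W \<omega>))) \<partial>M)"
    using ce(2) integral_cong_AE[OF _ _ ae] by (simp add: mult.commute)
  then show "(\<integral>\<omega>. D i \<omega> * f (W \<omega>) \<partial>M)
      = (\<integral>\<omega>. R \<omega> $ i * f (W \<omega>) \<partial>M) - (\<Sum>k\<in>UNIV. L $ i $ k * (\<integral>\<omega>. W \<omega> $ k * f (W \<omega>) \<partial>M))"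
    using Rf Wf by simp
qed

text \<open>For constant \<open>f\<close>, antisymmetry says that the increments have mean zero, and
  so does \<open>W\<close>. Hence the variance of a component of \<open>R\<close> is its second
  moment.\<close>

lemma integral_R: "(\<integral>\<omega>. R \<omega> $ i \<partial>M) = 0"
  using antisymmetry(2)[of "\<lambda>_. 1" i] integral_D_f[of "\<lambda>_. 1" i] by (simp add: integral_W)

text \<open>The two preceding identities for a coordinate function. This is where the covariance
  matrix enters the Stein operator; the correction by \<open>R\<close> causes the term with the
  square root of the norm of \<Sigma> in the coefficient of C.\<close>

lemma integral_D_D:
  "(\<integral>\<omega>. D i \<omega> * D j \<omega> \<partial>M) = 2 * (\<Sum>k\<in>UNIV. L $ i $ k * S $ k $ j) - 2 * (\<integral>\<omega>. R \<omega> $ i * W \<omega> $ j \<partial>M)"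
  using antisymmetry(2)[of "\<lambda>x. x $ j" i] integral_D_f[of "\<lambda>x. x $ j" i] square_integrable_W[of j]
  by (simp add: integral_W_W D_def)

definition V :: "'n \<Rightarrow> 'n \<Rightarrow> 'a \<Rightarrow> real" where
  "V i j = cond_exp_given M W (\<lambda>\<omega>. (W' \<omega> $ i - W \<omega> $ i) * (W' \<omega> $ j - W \<omega> $ j))"

lemma V_measurable [measurable]: "V i j \<in> borel_measurable M"
  by (simp add: V_def cond_exp_given_def)

text \<open>The factor \<open>f (W \<omega>)\<close> lets the product of increments be replaced by
  its conditional expectation. Splitting off the mean leaves a centred factor, controlled by the
  variance in \<open>stein_A\<close>; the mean itself is known from
  \<open>integral_D_D\<close>.\<close>

lemma integral_V_f:
  assumes [measurable]: "f \<in> borel_measurable borel" and b: "\<And>x. \<bar>f x\<bar> \<le> b"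
  shows "(\<integral>\<omega>. D i \<omega> * D j \<omega> * f (W \<omega>) \<partial>M)
    = (\<integral>\<omega>. (V i j \<omega> - integral\<^sup>L M (V i j)) * f (W \<omega>) \<partial>M) + (\<integral>\<omega>. D i \<omega> * D j \<omega> \<partial>M) * (\<integral>\<omega>. f (W \<omega>) \<partial>M)"
proof -
  have V: "V i j = real_cond_exp M (sigma_gen M W) (\<lambda>\<omega>. D i \<omega> * D j \<omega>)"
    by (simp add: V_def cond_exp_given_def D_def)
  have 1: "integrable M (\<lambda>\<omega>. f (W \<omega>) * (D i \<omega> * D j \<omega>))"
    using integrable_mult_bounded[OF integrable_D_D, of "\<lambda>\<omega>. f (W \<omega>)" b i j] b by (simp add: mult.commute)
  have "(\<lambda>\<omega>. D i \<omega> * D j \<omega>) \<in> borel_measurable M" by simp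
  note ce = real_cond_exp_intg[OF 1 measurable_sigma_gen this, OF assms(1), folded V]
  have "integral\<^sup>L M (V i j) = (\<integral>\<omega>. D i \<omega> * D j \<omega> \<partial>M)"
    unfolding V by (rule real_cond_exp_int(2)[OF integrable_D_D])
  moreover have "integrable M (\<lambda>\<omega>. f (W \<omega>))"
    using b by (intro integrable_const_bound[where B=b]) auto
  ultimately show ?thesis
    using ce by (simp add: algebra_simps)
qed

text \<open>The Taylor estimate is applied pointwise from \<open>W\<close> to \<open>W'\<close>,
  multiplied by the increment \<open>D i\<close> and integrated; the third moments of B come from
  the extra factor.\<close>

lemma remainder_le:
  fixes g :: "real^'n \<Rightarrow> real"
  assumes der: "\<And>x. (g has_derivative (\<lambda>v. \<Sum>j\<in>UNIV. G j x * v $ j)) (at x)"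
    and g: "\<And>x. \<bar>g x\<bar> \<le> a" and G: "\<And>j x. \<bar>G j x\<bar> \<le> b"
    and lip: "\<And>j x y. \<bar>G j y - G j x\<bar> \<le> c * (\<Sum>k\<in>UNIV. \<bar>y $ k - x $ k\<bar>)"
    and [measurable]: "g \<in> borel_measurable borel" "\<And>j. G j \<in> borel_measurable borel"
    and DDD: "\<And>j k. integrable M (\<lambda>\<omega>. \<bar>D i \<omega> * D j \<omega> * D k \<omega>\<bar>)"
  shows "\<bar>(\<integral>\<omega>. D i \<omega> * (g (W' \<omega>) - g (W \<omega>)) \<partial>M) - (\<Sum>j\<in>UNIV. \<integral>\<omega>. D i \<omega> * D j \<omega> * G j (W \<omega>) \<partial>M)\<bar>
    \<le> c / 2 * (\<Sum>j\<in>UNIV. \<Sum>k\<in>UNIV. \<integral>\<omega>. \<bar>D i \<omega> * D j \<omega> * D k \<omega>\<bar> \<partial>M)"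
proof -
  have g2: "integrable M (\<lambda>\<omega>. (g (W \<omega>))\<^sup>2)"
    using power_mono[OF g abs_ge_zero, of _ 2] by (intro integrable_const_bound[where B="a\<^sup>2"]) auto
  have 1: "integrable M (\<lambda>\<omega>. D i \<omega> * (g (W' \<omega>) - g (W \<omega>)))"
    using antisymmetry(1)[OF _ g2] integrable_D_f[OF _ g2] by (simp add: right_diff_distrib)
  have 2: "integrable M (\<lambda>\<omega>. D i \<omega> * D j \<omega> * G j (W \<omega>))" for j
    using G by (intro integrable_mult_bounded[OF integrable_D_D]) auto
  have "(\<integral>\<omega>. D i \<omega> * (g (W' \<omega>) - g (W \<omega>)) \<partial>M) - (\<Sum>j\<in>UNIV. \<integral>\<omega>. D i \<omega> * D j \<omega> * G j (W \<omega>) \<partial>M)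
      = (\<integral>\<omega>. D i \<omega> * (g (W' \<omega>) - g (W \<omega>)) - (\<Sum>j\<in>UNIV. D i \<omega> * D j \<omega> * G j (W \<omega>)) \<partial>M)"
    using 1 2 by simp
  also have "\<bar>\<dots>\<bar> \<le> (\<integral>\<omega>. c / 2 * (\<Sum>j\<in>UNIV. \<Sum>k\<in>UNIV. \<bar>D i \<omega> * D j \<omega> * D k \<omega>\<bar>) \<partial>M)"
  proof (rule order.trans[OF integral_abs_bound integral_mono])
    fix \<omega>
    have "D i \<omega> * (g (W' \<omega>) - g (W \<omega>)) - (\<Sum>j\<in>UNIV. D i \<omega> * D j \<omega> * G j (W \<omega>))
        = D i \<omega> * (g (W' \<omega>) - g (W \<omega>) - (\<Sum>j\<in>UNIV. G j (W \<omega>) * (W' \<omega> $ j - W \<omega> $ j)))"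
    proof -
      have "(\<Sum>j\<in>UNIV. D i \<omega> * D j \<omega> * G j (W \<omega>)) = D i \<omega> * (\<Sum>j\<in>UNIV. G j (W \<omega>) * (W' \<omega> $ j - W \<omega> $ j))"
        unfolding sum_distrib_left by (intro sum.cong refl) (simp add: D_def)
      then show ?thesis by (simp only: right_diff_distrib)
    qed
    also have "\<bar>\<dots>\<bar> \<le> \<bar>D i \<omega>\<bar> * (c / 2 * (\<Sum>j\<in>UNIV. \<Sum>k\<in>UNIV. \<bar>D j \<omega> * D k \<omega>\<bar>))"
      unfolding abs_mult[of "D i \<omega>"]
      by (rule mult_left_mono, unfold D_def, rule taylor_remainder_le[OF der lip]) simp
    finally show "\<bar>D i \<omega> * (g (W' \<omega>) - g (W \<omega>)) - (\<Sum>j\<in>UNIV. D i \<omega> * D j \<omega> * G j (W \<omega>))\<bar>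
        \<le> c / 2 * (\<Sum>j\<in>UNIV. \<Sum>k\<in>UNIV. \<bar>D i \<omega> * D j \<omega> * D k \<omega>\<bar>)"
      by (simp add: sum_distrib_left abs_mult ac_simps)
  qed (use 1 2 DDD in auto)
  also have "\<dots> = c / 2 * (\<Sum>j\<in>UNIV. \<Sum>k\<in>UNIV. \<integral>\<omega>. \<bar>D i \<omega> * D j \<omega> * D k \<omega>\<bar> \<partial>M)"
    using DDD by simp
  finally show ?thesis .
qed

section \<open>The quantities A, B and C as real sums\<close>

lemma finite_entries:
  shows "stein_A M W W' L < \<infinity> \<Longrightarrow> evariance M (V i j) < \<infinity>"
    and "stein_B M W W' L < \<infinity> \<Longrightarrow> (\<integral>\<^sup>+\<omega>. ennreal \<bar>D i \<omega> * D j \<omega> * D k \<omega>\<bar> \<partial>M) < \<infinity>"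
    and "stein_C M R L < \<infinity> \<Longrightarrow> evariance M (\<lambda>\<omega>. R \<omega> $ i) < \<infinity>"
  using lambda_weight_pos[OF inv_L, of i] ennreal_sqrt_finite_iff
  unfolding stein_A_def stein_B_def stein_C_def V_def D_def
  by (force simp: ennreal_sum_less_top ennreal_mult_less_top)+

lemma enn2real_stein_A:
  assumes "stein_A M W W' L < \<infinity>"
  shows "enn2real (stein_A M W W' L) = (\<Sum>i\<in>UNIV. lambda_weight L i * (\<Sum>j\<in>UNIV. std_dev M (V i j)))"
proof -
  have "ennreal_sqrt (evariance M (V i j)) < \<infinity>" for i j
    using finite_entries(1)[OF assms] ennreal_sqrt_finite_iff by blast
  then show ?thesis
    using lambda_weight_pos[OF inv_L]
    unfolding stein_A_def V_def[symmetric]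
    by (simp add: enn2real_sum ennreal_sum_less_top ennreal_mult_less_top enn2real_mult
        sum_distrib_left less_imp_le)
qed

lemma enn2real_stein_B:
  assumes "stein_B M W W' L < \<infinity>"
  shows "enn2real (stein_B M W W' L)
    = (\<Sum>i\<in>UNIV. lambda_weight L i * (\<Sum>j\<in>UNIV. \<Sum>k\<in>UNIV. \<integral>\<omega>. \<bar>D i \<omega> * D j \<omega> * D k \<omega>\<bar> \<partial>M))"
proof -
  have "(\<integral>\<omega>. \<bar>D i \<omega> * D j \<omega> * D k \<omega>\<bar> \<partial>M) = enn2real (\<integral>\<^sup>+\<omega>. ennreal \<bar>D i \<omega> * D j \<omega> * D k \<omega>\<bar> \<partial>M)" for i j k
    by (rule integral_eq_nn_integral) auto
  then show ?thesis
    using lambda_weight_pos[OF inv_L] finite_entries(2)[OF assms]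
    unfolding stein_B_def D_def[symmetric]
    by (simp add: enn2real_sum ennreal_sum_less_top ennreal_mult_less_top enn2real_mult
        sum_distrib_left less_imp_le)
qed

lemma enn2real_stein_C:
  assumes "stein_C M R L < \<infinity>"
  shows "enn2real (stein_C M R L) = (\<Sum>i\<in>UNIV. lambda_weight L i * std_dev M (\<lambda>\<omega>. R \<omega> $ i))"
proof -
  have "ennreal_sqrt (evariance M (\<lambda>\<omega>. R \<omega> $ i)) < \<infinity>" for i
    using finite_entries(3)[OF assms] ennreal_sqrt_finite_iff by blast
  then show ?thesis
    using lambda_weight_pos[OF inv_L]
    unfolding stein_C_def
    by (simp add: enn2real_sum ennreal_mult_less_top enn2real_mult less_imp_le)
qed

text \<open>The field \<open>g\<close> need not be a gradient. The factor 1/2 of the variance term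
  comes from antisymmetry, and the 1/4 of the third moments from antisymmetry together with the
  Taylor coefficient 1/2. The interpolation later supplies the remaining factors 1/2 and
  1/3.\<close>

proposition stein_operator_bound:
  fixes g :: "'n \<Rightarrow> real^'n \<Rightarrow> real"
  assumes der: "\<And>m x. (g m has_derivative (\<lambda>v. \<Sum>j\<in>UNIV. G m j x * v $ j)) (at x)"
    and g: "\<And>m x. \<bar>g m x\<bar> \<le> a" and G: "\<And>m j x. \<bar>G m j x\<bar> \<le> b"
    and lip: "\<And>m j x y. \<bar>G m j y - G m j x\<bar> \<le> c * (\<Sum>k\<in>UNIV. \<bar>y $ k - x $ k\<bar>)"
    and A: "stein_A M W W' L < \<infinity>" and B: "stein_B M W W' L < \<infinity>" and C: "stein_C M R L < \<infinity>"
  shows "\<bar>(\<Sum>m\<in>UNIV. \<integral>\<omega>. W \<omega> $ m * g m (W \<omega>) \<partial>M)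
      - (\<Sum>m\<in>UNIV. \<Sum>j\<in>UNIV. S $ m $ j * (\<integral>\<omega>. G m j (W \<omega>) \<partial>M))\<bar>
    \<le> b / 2 * enn2real (stein_A M W W' L) + c / 4 * enn2real (stein_B M W W' L)
      + (a + real CARD('n) * sqrt (matrix_sup_norm S) * b) * enn2real (stein_C M R L)"
proof -
  have contg: "continuous_on UNIV (g m)" for m
    using der by (meson differentiableI differentiable_imp_continuous_on differentiable_at_imp_differentiable_on)
  have [measurable]: "g m \<in> borel_measurable borel" "G m j \<in> borel_measurable borel" for m j
    using contg continuous_on_coordinate_lipschitz[OF lip] by (auto intro: borel_measurable_continuous_onI)
  have ab: "0 \<le> a" "0 \<le> b" using g G abs_ge_zero order.trans by blast+
  have g2: "integrable M (\<lambda>\<omega>. (g m (W \<omega>))\<^sup>2)" for m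
    using power_mono[OF g abs_ge_zero, of _ _ 2] by (intro integrable_const_bound[where B="a\<^sup>2"]) auto
  have G2: "integrable M (\<lambda>\<omega>. (G m j (W \<omega>))\<^sup>2)" for m j
    using power_mono[OF G abs_ge_zero, of _ _ _ 2] by (intro integrable_const_bound[where B="b\<^sup>2"]) auto
  have DDD: "integrable M (\<lambda>\<omega>. \<bar>D i \<omega> * D j \<omega> * D k \<omega>\<bar>)" for i j k
    using finite_entries(2)[OF B, of i j k] by (intro integrableI_bounded) auto
  define r where "r i = std_dev M (\<lambda>\<omega>. R \<omega> $ i)" for i
  \<comment> \<open>Components of \<open>R\<close> are already centred by \<open>integral_R\<close>,
    so the variance bound applies to them directly.\<close>
  have r: "\<bar>\<integral>\<omega>. R \<omega> $ i * Y \<omega> \<partial>M\<bar> \<le> sqrt y * r i"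
    if "Y \<in> borel_measurable M" "integrable M (\<lambda>\<omega>. (Y \<omega>)\<^sup>2)" "(\<integral>\<omega>. (Y \<omega>)\<^sup>2 \<partial>M) \<le> y" for i Y y
    using abs_integral_centred_mult_le(2)[OF _ that(1) finite_entries(3)[OF C] that(2,3), of i]
    by (simp add: integral_R r_def)
  define EG where "EG m j = (\<integral>\<omega>. G m j (W \<omega>) \<partial>M)" for m j
  define EV where "EV i m j = (\<integral>\<omega>. (V i j \<omega> - integral\<^sup>L M (V i j)) * G m j (W \<omega>) \<partial>M)" for i m j
  define Rg where "Rg i m = (\<integral>\<omega>. R \<omega> $ i * g m (W \<omega>) \<partial>M)" for i m
  define RW where "RW i j = (\<integral>\<omega>. R \<omega> $ i * W \<omega> $ j \<partial>M)" for i j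
  define Wg where "Wg m k = (\<integral>\<omega>. W \<omega> $ k * g m (W \<omega>) \<partial>M)" for m k
  define rem where "rem i m = (\<integral>\<omega>. D i \<omega> * (g m (W' \<omega>) - g m (W \<omega>)) \<partial>M)
    - (\<Sum>j\<in>UNIV. \<integral>\<omega>. D i \<omega> * D j \<omega> * G m j (W \<omega>) \<partial>M)" for i m
  define T where "T i m = Rg i m + (\<Sum>j\<in>UNIV. EV i m j) / 2 - (\<Sum>j\<in>UNIV. RW i j * EG m j) + rem i m / 2" for i m
  \<comment> \<open>This bound on \<open>T i m\<close> does not depend on \<open>m\<close>.
    Therefore the sum over \<open>m\<close> acts only on the entries of the inverse matrix and
    yields exactly the weight of \<open>i\<close>.\<close>
  define U where "U i = a * r i + b / 2 * (\<Sum>j\<in>UNIV. std_dev M (V i j))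
    + real CARD('n) * sqrt (matrix_sup_norm S) * b * r i
    + c / 4 * (\<Sum>j\<in>UNIV. \<Sum>k\<in>UNIV. \<integral>\<omega>. \<bar>D i \<omega> * D j \<omega> * D k \<omega>\<bar> \<partial>M)" for i
  define P where "P = matrix_inv L"
  \<comment> \<open>For fixed \<open>m\<close>, \<open>T _ m\<close> is \<Lambda> applied to the
    vector whose \<open>k\<close>-th entry is the Stein discrepancy with \<open>W $ k\<close> in
    place of \<open>W $ m\<close>. The contribution of \<Lambda>\<Sigma> to the second moments of
    the increments cancels, leaving four error terms: two with \<open>R\<close>, the centred
    conditional second moments, and the Taylor remainder.\<close>
  have T: "(\<Sum>k\<in>UNIV. L $ i $ k * Wg m k) - (\<Sum>k\<in>UNIV. L $ i $ k * (\<Sum>j\<in>UNIV. S $ k $ j * EG m j)) = T i m" for i m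
  proof -
    have "(\<Sum>k\<in>UNIV. L $ i $ k * Wg m k) = Rg i m - (\<integral>\<omega>. D i \<omega> * g m (W \<omega>) \<partial>M)"
      using integral_D_f[OF _ g2, of m i] by (simp add: Wg_def Rg_def)
    also have "\<dots> = Rg i m + (\<integral>\<omega>. D i \<omega> * (g m (W' \<omega>) - g m (W \<omega>)) \<partial>M) / 2"
      using antisymmetry(2)[OF _ g2, of m i] by simp
    also have "\<dots> = Rg i m + rem i m / 2 + (\<Sum>j\<in>UNIV. \<integral>\<omega>. D i \<omega> * D j \<omega> * G m j (W \<omega>) \<partial>M) / 2"
      by (simp add: rem_def diff_divide_distrib)
    also have "(\<Sum>j\<in>UNIV. \<integral>\<omega>. D i \<omega> * D j \<omega> * G m j (W \<omega>) \<partial>M)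
        = (\<Sum>j\<in>UNIV. EV i m j + (2 * (\<Sum>k\<in>UNIV. L $ i $ k * S $ k $ j) - 2 * RW i j) * EG m j)"
      using G by (intro sum.cong refl) (simp add: integral_V_f[where b=b] integral_D_D EV_def EG_def RW_def)
    also have "\<dots> = (\<Sum>j\<in>UNIV. EV i m j) - 2 * (\<Sum>j\<in>UNIV. RW i j * EG m j)
        + 2 * (\<Sum>j\<in>UNIV. (\<Sum>k\<in>UNIV. L $ i $ k * S $ k $ j) * EG m j)"
      by (simp add: sum.distrib sum_subtractf left_diff_distrib mult.assoc flip: sum_distrib_left)
    also have "(\<Sum>j\<in>UNIV. (\<Sum>k\<in>UNIV. L $ i $ k * S $ k $ j) * EG m j)
        = (\<Sum>k\<in>UNIV. L $ i $ k * (\<Sum>j\<in>UNIV. S $ k $ j * EG m j))"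
      unfolding sum_distrib_left sum_distrib_right by (subst sum.swap) (simp add: mult.assoc)
    finally show ?thesis by (simp add: T_def field_simps)
  qed
  have TU: "\<bar>T i m\<bar> \<le> U i" for i m
  proof -
    have 1: "\<bar>Rg i m\<bar> \<le> a * r i"
    proof -
      have "(\<integral>\<omega>. (g m (W \<omega>))\<^sup>2 \<partial>M) \<le> (\<integral>\<omega>. a\<^sup>2 \<partial>M)"
        using power_mono[OF g abs_ge_zero, of _ _ 2] g2 by (intro integral_mono) auto
      then show ?thesis
        using r[OF _ g2, of m "a\<^sup>2" i] ab by (simp add: Rg_def prob_space)
    qed
    have 2: "\<bar>EV i m j\<bar> \<le> b * std_dev M (V i j)" for j
    proof -
      have "(\<integral>\<omega>. (G m j (W \<omega>))\<^sup>2 \<partial>M) \<le> (\<integral>\<omega>. b\<^sup>2 \<partial>M)"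
        using power_mono[OF G abs_ge_zero, of _ _ _ 2] G2 by (intro integral_mono) auto
      then show ?thesis
        using abs_integral_centred_mult_le(2)[OF _ _ finite_entries(1)[OF A] G2, of i j m j "b\<^sup>2"] ab
        by (simp add: EV_def prob_space)
    qed
    \<comment> \<open>The second moment of \<open>W $ j\<close> is a diagonal entry of
      \<open>S\<close>, hence at most its largest entry; the later summation over \<open>j\<close>
      contributes the dimension.\<close>
    have 3: "\<bar>RW i j * EG m j\<bar> \<le> sqrt (matrix_sup_norm S) * r i * b" for j
    proof -
      have "(\<integral>\<omega>. (W \<omega> $ j)\<^sup>2 \<partial>M) \<le> matrix_sup_norm S"
        using integral_W_W[of j j] abs_le_matrix_sup_norm[of S j j] by (simp add: power2_eq_square)
      then have "\<bar>RW i j\<bar> \<le> sqrt (matrix_sup_norm S) * r i"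
        unfolding RW_def by (intro r square_integrable_W) auto
      moreover have "\<bar>EG m j\<bar> \<le> (\<integral>\<omega>. b \<partial>M)"
        unfolding EG_def using G
        by (intro order.trans[OF integral_abs_bound integral_mono]) (auto intro!: integrable_const_bound[where B=b])
      ultimately show ?thesis
        unfolding abs_mult by (intro mult_mono) (auto simp: prob_space intro: order.trans[OF abs_ge_zero])
    qed
    have 4: "\<bar>rem i m\<bar> \<le> c / 2 * (\<Sum>j\<in>UNIV. \<Sum>k\<in>UNIV. \<integral>\<omega>. \<bar>D i \<omega> * D j \<omega> * D k \<omega>\<bar> \<partial>M)"
      unfolding rem_def by (rule remainder_le[OF der g G lip _ _ DDD]) auto
    have "\<bar>\<Sum>j\<in>UNIV. EV i m j\<bar> \<le> (\<Sum>j\<in>UNIV. b * std_dev M (V i j))"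
      by (intro order.trans[OF sum_abs] sum_mono 2)
    moreover have "\<bar>\<Sum>j\<in>UNIV. RW i j * EG m j\<bar> \<le> (\<Sum>j\<in>(UNIV::'n set). sqrt (matrix_sup_norm S) * r i * b)"
      by (intro order.trans[OF sum_abs] sum_mono 3)
    ultimately show ?thesis
      using 1 4 unfolding T_def U_def sum_distrib_left[symmetric] sum_constant by (simp add: ac_simps)
  qed
  \<comment> \<open>Row \<open>m\<close> of the inverse, applied to \<open>T _ m\<close>, undoes
    \<Lambda> and returns the \<open>m\<close>-th entry of that vector. Summing over
    \<open>m\<close> gives the discrepancy of the field.\<close>
  have "(\<Sum>m\<in>UNIV. Wg m m) - (\<Sum>m\<in>UNIV. \<Sum>j\<in>UNIV. S $ m $ j * EG m j)
      = (\<Sum>m\<in>UNIV. \<Sum>i\<in>UNIV. P $ m $ i * T i m)"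
    unfolding T[symmetric] right_diff_distrib sum_subtractf P_def
    by (simp add: matrix_inv_cancel[OF inv_L] matrix_inv_cancel[OF inv_L, where x="Wg _"])
  also have "\<bar>\<dots>\<bar> \<le> (\<Sum>m\<in>UNIV. \<Sum>i\<in>UNIV. \<bar>P $ m $ i\<bar> * U i)"
    using TU by (intro order.trans[OF sum_abs] sum_mono) (auto simp: abs_mult intro!: mult_left_mono)
  also have "\<dots> = (\<Sum>i\<in>UNIV. lambda_weight L i * U i)"
    unfolding lambda_weight_def P_def sum_distrib_right by (rule sum.swap)
  also have "\<dots> = b / 2 * enn2real (stein_A M W W' L) + c / 4 * enn2real (stein_B M W W' L)
      + (a + real CARD('n) * sqrt (matrix_sup_norm S) * b) * enn2real (stein_C M R L)"
  proof -
    define v where "v i = (\<Sum>j\<in>UNIV. std_dev M (V i j))" for i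
    define w where "w i = (\<Sum>j\<in>UNIV. \<Sum>k\<in>UNIV. \<integral>\<omega>. \<bar>D i \<omega> * D j \<omega> * D k \<omega>\<bar> \<partial>M)" for i
    have "(\<Sum>i\<in>UNIV. lambda_weight L i * U i) = (\<Sum>i\<in>UNIV. b / 2 * (lambda_weight L i * v i) + c / 4 * (lambda_weight L i * w i)
        + (a + real CARD('n) * sqrt (matrix_sup_norm S) * b) * (lambda_weight L i * r i))"
      unfolding U_def v_def[symmetric] w_def[symmetric] by (simp add: algebra_simps)
    then show ?thesis
      unfolding enn2real_stein_A[OF A] enn2real_stein_B[OF B] enn2real_stein_C[OF C]
        r_def[symmetric] v_def[symmetric] w_def[symmetric]
      by (simp add: sum.distrib sum_distrib_left)
  qed
  finally show ?thesis unfolding Wg_def EG_def .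
qed

end

subsection \<open>Interpolation\<close>

text \<open>By the mean value inequality \<open>K\<close> dominates all difference quotients, so
  dominated convergence applies along every sequence of increments tending to 0.\<close>

lemma has_real_derivative_integral:
  fixes f f' :: "real \<Rightarrow> 'a \<Rightarrow> real"
  assumes f: "\<And>t. integrable M (f t)" and f' [measurable]: "f' t \<in> borel_measurable M"
    and K: "integrable M K"
    and der: "\<And>t \<omega>. ((\<lambda>t. f t \<omega>) has_real_derivative f' t \<omega>) (at t)"
    and bound: "\<And>t \<omega>. \<bar>f' t \<omega>\<bar> \<le> K \<omega>"
  shows "((\<lambda>t. \<integral>\<omega>. f t \<omega> \<partial>M) has_real_derivative (\<integral>\<omega>. f' t \<omega> \<partial>M)) (at t)"
proof -
  have [measurable]: "f s \<in> borel_measurable M" for s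
    using f by auto
  have "(\<lambda>n. ((\<integral>\<omega>. f (t + X n) \<omega> \<partial>M) - (\<integral>\<omega>. f t \<omega> \<partial>M)) / X n) \<longlonglongrightarrow> (\<integral>\<omega>. f' t \<omega> \<partial>M)"
    if X: "\<And>n. X n \<noteq> 0" "X \<longlonglongrightarrow> 0" for X :: "nat \<Rightarrow> real"
  proof -
    have "(\<lambda>n. \<integral>\<omega>. (f (t + X n) \<omega> - f t \<omega>) / X n \<partial>M) \<longlonglongrightarrow> (\<integral>\<omega>. f' t \<omega> \<partial>M)"
    proof (rule integral_dominated_convergence[where w=K])
      show "(\<lambda>\<omega>. (f (t + X n) \<omega> - f t \<omega>) / X n) \<in> borel_measurable M" for n
        by measurable
      have "((\<lambda>h. (f (t + h) \<omega> - f t \<omega>) / h) \<longlongrightarrow> f' t \<omega>) (at 0)" for \<omega>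
        using der[of \<omega> t] by (simp add: DERIV_def)
      then show "AE \<omega> in M. (\<lambda>n. (f (t + X n) \<omega> - f t \<omega>) / X n) \<longlonglongrightarrow> f' t \<omega>"
        using X unfolding tendsto_at_iff_sequentially by (auto simp: o_def)
      have "norm (f (t + X n) \<omega> - f t \<omega>) \<le> K \<omega> * norm (t + X n - t)" for n \<omega>
        by (rule field_differentiable_bound[where S=UNIV]) (use der bound in auto)
      then show "AE \<omega> in M. norm ((f (t + X n) \<omega> - f t \<omega>) / X n) \<le> K \<omega>" for n
        using X(1)[of n] by (auto simp: field_simps)
    qed (use K in auto)
    then show ?thesis using f by simp
  qed
  then show ?thesis
    unfolding DERIV_def tendsto_at_iff_sequentially by (auto simp: o_def)
qed

lemma integrable_pair_mult:
  fixes u :: "'a \<Rightarrow> real" and v :: "'b \<Rightarrow> real"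
  assumes "pair_sigma_finite M N" and u: "integrable M u" and v: "integrable N v"
  shows "integrable (M \<Otimes>\<^sub>M N) (\<lambda>(x, y). u x * v y)"
proof -
  interpret pair_sigma_finite M N by fact
  have [measurable]: "u \<in> borel_measurable M" "v \<in> borel_measurable N" using u v by auto
  show ?thesis
    by (rule Fubini_integrable) (use u v in \<open>auto simp: abs_mult\<close>)
qed

context exchangeable_regression
begin

text \<open>Stated with real bounds and any symmetric root \<open>Q\<close> of the covariance
  matrix, so that neither \<open>ennreal\<close> nor the choice of the root interferes with the
  analysis.\<close>

proposition interpolation_bound:
  fixes g :: "'n \<Rightarrow> real^'n \<Rightarrow> real" and Z :: "'b \<Rightarrow> real^'n"
  assumes N: "prob_space N" and Z: "standard_normal_vector N Z"
    and Q: "transpose Q = Q" "Q ** Q = S"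
    and derh: "\<And>x. (h has_derivative (\<lambda>v. \<Sum>m\<in>UNIV. g m x * v $ m)) (at x)"
    and der: "\<And>m x. (g m has_derivative (\<lambda>v. \<Sum>j\<in>UNIV. G m j x * v $ j)) (at x)"
    and g: "\<And>m x. \<bar>g m x\<bar> \<le> a" and G: "\<And>m j x. \<bar>G m j x\<bar> \<le> b"
    and lip: "\<And>m j x y. \<bar>G m j y - G m j x\<bar> \<le> c * (\<Sum>k\<in>UNIV. \<bar>y $ k - x $ k\<bar>)"
    and A: "stein_A M W W' L < \<infinity>" and B: "stein_B M W W' L < \<infinity>" and C: "stein_C M R L < \<infinity>"
  shows "\<bar>(\<integral>\<omega>. h (W \<omega>) \<partial>M) - (\<integral>\<omega>. h (Q *v Z \<omega>) \<partial>N)\<bar>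
    \<le> b / 4 * enn2real (stein_A M W W' L) + c / 12 * enn2real (stein_B M W W' L)
      + (a + 1 / 2 * real CARD('n) * sqrt (matrix_sup_norm S) * b) * enn2real (stein_C M R L)"
proof -
  interpret N: prob_space N by fact
  interpret MN: pair_prob_space M N ..
  have pair: "pair_sigma_finite M N" ..
  have conth: "continuous_on UNIV h" and contg: "continuous_on UNIV (g m)" for m
    using derh der by (meson differentiableI differentiable_imp_continuous_on differentiable_at_imp_differentiable_on)+
  have contG: "continuous_on UNIV (G m j)" for m j
    by (rule continuous_on_coordinate_lipschitz[OF lip])
  have [measurable]: "h \<in> borel_measurable borel" "g m \<in> borel_measurable borel" "G m j \<in> borel_measurable borel" for m j
    using conth contg contG by (auto intro: borel_measurable_continuous_onI)
  have [measurable]: "Z \<in> borel_measurable N"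
    using Z distributed_measurable by (fastforce simp: standard_normal_vector_def)
  define Y where "Y \<omega> = Q *v Z \<omega>" for \<omega>
  have [measurable]: "Y \<in> borel_measurable N"
    unfolding Y_def
    by (rule measurable_compose[OF _ borel_measurable_continuous_onI[OF matrix_vector_mult_linear_continuous_on]]) simp
  have Y_nth: "Y \<omega> $ m = (\<Sum>k\<in>UNIV. Q $ m $ k * Z \<omega> $ k)" for \<omega> m
    by (simp add: Y_def matrix_vector_mult_def)
  have intY: "integrable N (\<lambda>\<omega>. Y \<omega> $ m)" for m
    unfolding Y_nth using standard_normal_vector_integrable_component[OF Z] by auto
  \<comment> \<open>The squares of the two coefficients add up to 1. As \<open>W\<close> and
    \<open>Y\<close> are independent on the product space, with the same covariance matrix, that
    matrix is kept along the whole path.\<close>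
  define X where "X t \<omega> y = sin t *\<^sub>R W \<omega> + cos t *\<^sub>R y" for t \<omega> and y :: "real^'n"
  have X_measurable [measurable]: "(\<lambda>p. X t (fst p) (Y (snd p))) \<in> borel_measurable (M \<Otimes>\<^sub>M N)" for t
    unfolding X_def by measurable
  have [measurable]: "(\<lambda>\<omega>. X t \<omega> y) \<in> borel_measurable M" for t y
    unfolding X_def by measurable
  have [measurable]: "(\<lambda>\<omega>'. X t \<omega> (Y \<omega>')) \<in> borel_measurable N" for t \<omega>
    unfolding X_def by measurable
  define EG where "EG t m j = (\<integral>(\<omega>, \<omega>'). G m j (X t \<omega> (Y \<omega>')) \<partial>(M \<Otimes>\<^sub>M N))" for t m j

  have iW: "integrable (M \<Otimes>\<^sub>M N) (\<lambda>(\<omega>, \<omega>'). W \<omega> $ m)" and iY: "integrable (M \<Otimes>\<^sub>M N) (\<lambda>(\<omega>, \<omega>'). Y \<omega>' $ m)" for m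
    using integrable_pair_mult[OF pair integrable_W[of m], of "\<lambda>_. 1"]
      integrable_pair_mult[OF pair _ intY[of m], of "\<lambda>_. 1"] by simp_all
  have iWg: "integrable (M \<Otimes>\<^sub>M N) (\<lambda>(\<omega>, \<omega>'). W \<omega> $ m * g m (X t \<omega> (Y \<omega>')))"
    and iYg: "integrable (M \<Otimes>\<^sub>M N) (\<lambda>(\<omega>, \<omega>'). Y \<omega>' $ m * g m (X t \<omega> (Y \<omega>')))"
    and iG: "integrable (M \<Otimes>\<^sub>M N) (\<lambda>(\<omega>, \<omega>'). G m j (X t \<omega> (Y \<omega>')))" for m j t
    using integrable_mult_bounded[OF iW, of "\<lambda>p. g m (X t (fst p) (Y (snd p)))" a m]
      integrable_mult_bounded[OF iY, of "\<lambda>p. g m (X t (fst p) (Y (snd p)))" a m]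
      MN.integrable_const_bound[of "\<lambda>p. G m j (X t (fst p) (Y (snd p)))" b] g G
    by (simp_all add: case_prod_unfold)

  \<comment> \<open>With \<open>W \<omega>\<close> frozen, this is Gaussian integration by parts in
    \<open>Z\<close>. The chain rule brings the factor cos t and one matrix \<open>Q\<close>, the
    expansion of \<open>Y\<close> brings the other, and by symmetry of \<open>Q\<close> their
    product is \<open>S\<close>.\<close>
  have parts: "(\<integral>(\<omega>, \<omega>'). Y \<omega>' $ m * g m (X t \<omega> (Y \<omega>')) \<partial>(M \<Otimes>\<^sub>M N))
      = cos t * (\<Sum>j\<in>UNIV. S $ m $ j * EG t m j)" for m t
  proof -
    have "(\<integral>\<omega>'. Y \<omega>' $ m * g m (X t \<omega> (Y \<omega>')) \<partial>N)
        = (\<Sum>j\<in>UNIV. cos t * S $ m $ j * (\<integral>\<omega>'. G m j (X t \<omega> (Y \<omega>')) \<partial>N))" for \<omega>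
    proof -
      define f where "f z = g m (sin t *\<^sub>R W \<omega> + cos t *\<^sub>R (Q *v z))" for z
      define F where "F z v = (\<Sum>j\<in>UNIV. G m j (sin t *\<^sub>R W \<omega> + cos t *\<^sub>R (Q *v z)) * (cos t *\<^sub>R (Q *v v)) $ j)" for z v
      have QQ: "(\<Sum>k\<in>UNIV. Q $ m $ k * Q $ j $ k) = S $ m $ j" for j
      proof -
        have "S $ m $ j = (Q ** transpose Q) $ m $ j" by (simp add: Q)
        then show ?thesis by (simp add: matrix_matrix_mult_def transpose_def)
      qed
      have f_Z: "f (Z \<omega>') = g m (X t \<omega> (Y \<omega>'))" for \<omega>'
        by (simp add: f_def X_def Y_def)
      have derf: "(f has_derivative F z) (at z)" for z
      proof -
        have "((\<lambda>z. sin t *\<^sub>R W \<omega> + cos t *\<^sub>R (Q *v z)) has_derivative (\<lambda>v. cos t *\<^sub>R (Q *v v))) (at z)"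
          by (auto intro!: derivative_eq_intros bounded_linear.has_derivative[OF matrix_vector_mul_bounded_linear])
        from has_derivative_compose[OF this der[of m]]
        show ?thesis unfolding f_def F_def by simp
      qed
      have F_axis: "F z (axis k 1) = (\<Sum>j\<in>UNIV. cos t * Q $ j $ k * G m j (sin t *\<^sub>R W \<omega> + cos t *\<^sub>R (Q *v z)))" for z k
        by (simp add: F_def matrix_vector_mult_basis column_def mult_ac)
      have ibp: "(\<integral>\<omega>'. Z \<omega>' $ k * f (Z \<omega>') \<partial>N) = (\<integral>\<omega>'. F (Z \<omega>') (axis k 1) \<partial>N)" for k
      proof (rule std_normal_vector_integration_by_parts[OF N Z derf])
        show "continuous_on UNIV (\<lambda>x. F x (axis k 1))"
          unfolding F_axis
          by (intro continuous_intros continuous_on_compose2[OF contG] matrix_vector_mult_linear_continuous_on) auto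
        show "\<bar>f x\<bar> \<le> a" for x by (simp add: f_def g)
        show "\<bar>F x (axis k 1)\<bar> \<le> (\<Sum>j\<in>UNIV. \<bar>cos t * Q $ j $ k\<bar> * b)" for x
          unfolding F_axis using G
          by (intro order.trans[OF sum_abs] sum_mono) (auto simp: abs_mult intro!: mult_left_mono)
      qed
      have iGN: "integrable N (\<lambda>\<omega>'. G m j (X t \<omega> (Y \<omega>')))" for j
        using G by (intro N.integrable_const_bound[where B=b]) auto
      have iZf: "integrable N (\<lambda>\<omega>'. Z \<omega>' $ k * f (Z \<omega>'))" for k
        unfolding f_Z using g
        by (intro integrable_mult_bounded[OF standard_normal_vector_integrable_component[OF Z]]) auto
      have "(\<integral>\<omega>'. Y \<omega>' $ m * g m (X t \<omega> (Y \<omega>')) \<partial>N) = (\<integral>\<omega>'. (\<Sum>k\<in>UNIV. Q $ m $ k * (Z \<omega>' $ k * f (Z \<omega>'))) \<partial>N)"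
        unfolding f_Z by (simp add: Y_nth sum_distrib_right mult.assoc)
      also have "\<dots> = (\<Sum>k\<in>UNIV. Q $ m $ k * (\<integral>\<omega>'. F (Z \<omega>') (axis k 1) \<partial>N))"
        using iZf by (simp add: ibp)
      also have "\<dots> = (\<Sum>k\<in>UNIV. Q $ m $ k * (\<Sum>j\<in>UNIV. cos t * Q $ j $ k * (\<integral>\<omega>'. G m j (X t \<omega> (Y \<omega>')) \<partial>N)))"
        using iGN by (simp add: F_axis X_def Y_def)
      also have "\<dots> = (\<Sum>j\<in>UNIV. cos t * (\<Sum>k\<in>UNIV. Q $ m $ k * Q $ j $ k) * (\<integral>\<omega>'. G m j (X t \<omega> (Y \<omega>')) \<partial>N))"
        unfolding sum_distrib_left sum_distrib_right by (subst sum.swap) (simp add: mult_ac)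
      finally show ?thesis by (simp only: QQ)
    qed
    then have "(\<integral>(\<omega>, \<omega>'). Y \<omega>' $ m * g m (X t \<omega> (Y \<omega>')) \<partial>(M \<Otimes>\<^sub>M N))
        = (\<integral>\<omega>. (\<Sum>j\<in>UNIV. cos t * S $ m $ j * (\<integral>\<omega>'. G m j (X t \<omega> (Y \<omega>')) \<partial>N)) \<partial>M)"
      by (subst MN.integral_fst[OF iYg, symmetric]) simp
    also have "\<dots> = (\<Sum>j\<in>UNIV. cos t * S $ m $ j * EG t m j)"
      using MN.integrable_fst[OF iG] MN.integral_fst[OF iG] by (simp add: EG_def)
    finally show ?thesis by (simp add: sum_distrib_left mult.assoc)
  qed

  define f where "f t p = h (X t (fst p) (Y (snd p)))" for t p
  define f' where "f' t p = (\<Sum>m\<in>UNIV. g m (X t (fst p) (Y (snd p))) * (cos t * W (fst p) $ m - sin t * Y (snd p) $ m))" for t p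
  \<comment> \<open>One dominating function for all t: it bounds \<open>f' t\<close> for
    differentiation under the integral and, with \<open>\<bar>h 0\<bar>\<close> added, the linear
    growth of \<open>h\<close> itself.\<close>
  define K where "K p = a * (\<Sum>m\<in>UNIV. \<bar>W (fst p) $ m\<bar> + \<bar>Y (snd p) $ m\<bar>)" for p
  have a0: "0 \<le> a" using g abs_ge_zero order.trans by blast
  have K: "integrable (M \<Otimes>\<^sub>M N) K"
    using integrable_abs[OF iW] integrable_abs[OF iY] unfolding K_def by (simp add: case_prod_unfold)
  have f_int: "integrable (M \<Otimes>\<^sub>M N) (f t)" for t
  proof (rule Bochner_Integration.integrable_bound)
    show "integrable (M \<Otimes>\<^sub>M N) (\<lambda>p. \<bar>h 0\<bar> + K p)" using K by simp
    have "\<bar>f t p\<bar> \<le> \<bar>h 0\<bar> + K p" for p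
    proof -
      have "\<bar>h (X t (fst p) (Y (snd p))) - h 0\<bar> \<le> a * (\<Sum>k\<in>UNIV. \<bar>X t (fst p) (Y (snd p)) $ k - 0 $ k\<bar>)"
        using g by (intro abs_diff_le_of_partials[OF derh]) (simp add: axis_def if_distrib cong: if_cong)
      also have "\<dots> \<le> K p"
        unfolding K_def
      proof (intro mult_left_mono sum_mono a0)
        fix k
        have "\<bar>sin t * W (fst p) $ k\<bar> \<le> 1 * \<bar>W (fst p) $ k\<bar>" "\<bar>cos t * Y (snd p) $ k\<bar> \<le> 1 * \<bar>Y (snd p) $ k\<bar>"
          unfolding abs_mult by (intro mult_right_mono; simp)+
        then show "\<bar>X t (fst p) (Y (snd p)) $ k - 0 $ k\<bar> \<le> \<bar>W (fst p) $ k\<bar> + \<bar>Y (snd p) $ k\<bar>"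
          by (simp add: X_def)
      qed
      finally show ?thesis by (simp add: f_def)
    qed
    then show "AE p in M \<Otimes>\<^sub>M N. norm (f t p) \<le> norm (\<bar>h 0\<bar> + K p)"
      by (intro AE_I2) (metis abs_ge_self order.trans real_norm_def)
  qed (simp add: f_def[abs_def])
  have f'_bound: "\<bar>f' t p\<bar> \<le> K p" for t p
    unfolding f'_def K_def sum_distrib_left
  proof (intro order.trans[OF sum_abs] sum_mono)
    fix m
    have "\<bar>cos t * W (fst p) $ m\<bar> \<le> 1 * \<bar>W (fst p) $ m\<bar>" "\<bar>sin t * Y (snd p) $ m\<bar> \<le> 1 * \<bar>Y (snd p) $ m\<bar>"
      unfolding abs_mult by (intro mult_right_mono; simp)+
    then have "\<bar>cos t * W (fst p) $ m - sin t * Y (snd p) $ m\<bar> \<le> \<bar>W (fst p) $ m\<bar> + \<bar>Y (snd p) $ m\<bar>"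
      by linarith
    then show "\<bar>g m (X t (fst p) (Y (snd p))) * (cos t * W (fst p) $ m - sin t * Y (snd p) $ m)\<bar>
        \<le> a * (\<bar>W (fst p) $ m\<bar> + \<bar>Y (snd p) $ m\<bar>)"
      unfolding abs_mult using g a0 by (intro mult_mono) auto
  qed
  have f_der: "((\<lambda>t. f t p) has_real_derivative f' t p) (at t)" for t p
  proof -
    have X_der: "((\<lambda>t. X t (fst p) (Y (snd p))) has_derivative
        (\<lambda>s. s *\<^sub>R (cos t *\<^sub>R W (fst p) - sin t *\<^sub>R Y (snd p)))) (at t)"
      unfolding X_def by (auto intro!: derivative_eq_intros simp: algebra_simps)
    have eq: "(\<lambda>s. \<Sum>m\<in>UNIV. g m (X t (fst p) (Y (snd p))) *
        (s *\<^sub>R (cos t *\<^sub>R W (fst p) - sin t *\<^sub>R Y (snd p))) $ m) = (*) (f' t p)"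
      by (rule ext) (simp add: f'_def sum_distrib_left mult_ac)
    show ?thesis
      using has_derivative_compose[OF X_der derh] unfolding f_def has_field_derivative_def eq .
  qed
  have f'_meas: "f' t \<in> borel_measurable (M \<Otimes>\<^sub>M N)" for t
    unfolding f'_def[abs_def] by measurable
  define \<phi> where "\<phi> t = (\<integral>p. f t p \<partial>(M \<Otimes>\<^sub>M N))" for t
  have \<phi>_iterated: "\<phi> t = (\<integral>\<omega>. \<integral>\<omega>'. f t (\<omega>, \<omega>') \<partial>N \<partial>M)" for t
    unfolding \<phi>_def by (rule MN.integral_fst'[OF f_int, symmetric])
  have \<phi>_der: "(\<phi> has_real_derivative (\<integral>p. f' t p \<partial>(M \<Otimes>\<^sub>M N))) (at t)" for t
    unfolding \<phi>_def by (rule has_real_derivative_integral[OF f_int f'_meas K f_der f'_bound])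

  define a' b' c' where "a' = enn2real (stein_A M W W' L)" and "b' = enn2real (stein_B M W W' L)"
    and "c' = enn2real (stein_C M R L)"
  define d where "d = real CARD('n) * sqrt (matrix_sup_norm S)"
  \<comment> \<open>The bound of \<open>stein_operator_bound\<close> for the rescaled field with s =
    sin t: its values keep the bound \<open>a\<close>, its partial derivatives gain a factor s, and
    their Lipschitz constant gains s^2.\<close>
  define bd where "bd s = s * b / 2 * a' + s\<^sup>2 * c / 4 * b' + (a + d * (s * b)) * c'" for s
  have \<phi>'_bound: "\<bar>\<integral>p. f' t p \<partial>(M \<Otimes>\<^sub>M N)\<bar> \<le> cos t * bd (sin t)" if t: "0 < t" "t < pi / 2" for t
  proof -
    have s: "0 \<le> sin t" "0 \<le> cos t" using t by (auto intro: sin_ge_zero cos_ge_zero)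
    \<comment> \<open>The Stein discrepancy of the field for frozen \<open>Y \<omega>'\<close>.
      Fubini is used here in the order opposite to that in \<open>parts\<close>, with the integral
      over \<open>M\<close> inside.\<close>
    define \<Psi> where "\<Psi> \<omega>' = (\<Sum>m\<in>UNIV. \<integral>\<omega>. W \<omega> $ m * g m (X t \<omega> (Y \<omega>')) \<partial>M)
      - (\<Sum>m\<in>UNIV. \<Sum>j\<in>UNIV. S $ m $ j * (\<integral>\<omega>. sin t * G m j (X t \<omega> (Y \<omega>')) \<partial>M))" for \<omega>'
    have "(\<integral>p. f' t p \<partial>(M \<Otimes>\<^sub>M N))
        = (\<Sum>m\<in>UNIV. cos t * (\<integral>(\<omega>, \<omega>'). W \<omega> $ m * g m (X t \<omega> (Y \<omega>')) \<partial>(M \<Otimes>\<^sub>M N))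
          - sin t * (\<integral>(\<omega>, \<omega>'). Y \<omega>' $ m * g m (X t \<omega> (Y \<omega>')) \<partial>(M \<Otimes>\<^sub>M N)))"
    proof -
      have "f' t p = (\<Sum>m\<in>UNIV. cos t * (case p of (\<omega>, \<omega>') \<Rightarrow> W \<omega> $ m * g m (X t \<omega> (Y \<omega>')))
          - sin t * (case p of (\<omega>, \<omega>') \<Rightarrow> Y \<omega>' $ m * g m (X t \<omega> (Y \<omega>'))))" for p
        by (simp add: f'_def case_prod_unfold algebra_simps)
      then show ?thesis
        using iWg iYg by simp
    qed
    \<comment> \<open>The factor cos t from \<open>parts\<close> joins the one in front of
      \<open>W\<close> and comes out. The remaining sin t turns \<open>G m j\<close> into the
      partial derivative of the rescaled field.\<close>
    also have "\<dots> = cos t * ((\<Sum>m\<in>UNIV. (\<integral>(\<omega>, \<omega>'). W \<omega> $ m * g m (X t \<omega> (Y \<omega>')) \<partial>(M \<Otimes>\<^sub>M N)))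
        - (\<Sum>m\<in>UNIV. \<Sum>j\<in>UNIV. S $ m $ j * (sin t * EG t m j)))"
      unfolding parts by (simp add: sum_subtractf right_diff_distrib sum_distrib_left mult_ac)
    also have "\<dots> = cos t * (\<integral>\<omega>'. \<Psi> \<omega>' \<partial>N)"
      unfolding \<Psi>_def EG_def MN.integral_snd[OF iWg, symmetric] MN.integral_snd[OF iG, symmetric]
      using MN.integrable_snd[OF iWg] MN.integrable_snd[OF iG] by simp
    also have "\<bar>\<dots>\<bar> = cos t * \<bar>\<integral>\<omega>'. \<Psi> \<omega>' \<partial>N\<bar>" using s by (simp add: abs_mult)
    also have "\<dots> \<le> cos t * (\<integral>\<omega>'. bd (sin t) \<partial>N)"
    proof (intro mult_left_mono s order.trans[OF integral_abs_bound integral_mono])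
      have "integrable N \<Psi>"
        unfolding \<Psi>_def using MN.integrable_snd[OF iWg] MN.integrable_snd[OF iG] by simp
      then show "integrable N (\<lambda>\<omega>'. \<bar>\<Psi> \<omega>'\<bar>)" by simp
      fix \<omega>'
      let ?l = "\<lambda>x. sin t *\<^sub>R x + cos t *\<^sub>R Y \<omega>'"
      have "\<bar>\<Psi> \<omega>'\<bar> \<le> (sin t * b) / 2 * a' + ((sin t)\<^sup>2 * c) / 4 * b'
          + (a + real CARD('n) * sqrt (matrix_sup_norm S) * (sin t * b)) * c'"
        unfolding \<Psi>_def X_def a'_def b'_def c'_def
      proof (rule stein_operator_bound[OF _ _ _ _ A B C])
        show "((\<lambda>x. g m (?l x)) has_derivative (\<lambda>v. \<Sum>j\<in>UNIV. sin t * G m j (?l x) * v $ j)) (at x)" for m x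
        proof -
          have "(?l has_derivative (\<lambda>v. sin t *\<^sub>R v)) (at x)"
            by (auto intro!: derivative_eq_intros)
          from has_derivative_compose[OF this der[of m]] show ?thesis by (simp add: mult_ac)
        qed
        show "\<bar>g m (?l x)\<bar> \<le> a" for m x by (rule g)
        show "\<bar>sin t * G m j (?l x)\<bar> \<le> sin t * b" for m j x
          using s G by (simp add: abs_mult mult_left_mono)
        show "\<bar>sin t * G m j (?l y) - sin t * G m j (?l x)\<bar> \<le> (sin t)\<^sup>2 * c * (\<Sum>k\<in>UNIV. \<bar>y $ k - x $ k\<bar>)" for m j x y
        proof -
          have "\<bar>sin t * G m j (?l y) - sin t * G m j (?l x)\<bar> = sin t * \<bar>G m j (?l y) - G m j (?l x)\<bar>"
            using s by (simp add: abs_mult flip: right_diff_distrib)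
          also have "\<dots> \<le> sin t * (c * (\<Sum>k\<in>UNIV. \<bar>?l y $ k - ?l x $ k\<bar>))"
            using s by (intro mult_left_mono lip) auto
          also have "(\<Sum>k\<in>UNIV. \<bar>?l y $ k - ?l x $ k\<bar>) = sin t * (\<Sum>k\<in>UNIV. \<bar>y $ k - x $ k\<bar>)"
            using s by (simp add: sum_distrib_left abs_mult flip: right_diff_distrib)
          finally show ?thesis by (simp add: power2_eq_square mult_ac)
        qed
      qed
      then show "\<bar>\<Psi> \<omega>'\<bar> \<le> bd (sin t)" by (simp add: bd_def d_def)
    qed simp
    finally show ?thesis by (simp add: N.prob_space)
  qed

  \<comment> \<open>An antiderivative of \<open>cos t * bd (sin t)\<close>, found by substituting s
    = sin t: the terms of degree 0, 1, 2 in s acquire the factors 1, 1/2, 1/3. It vanishes at 0, and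
    at pi/2 it is the claimed bound.\<close>
  define \<beta> where "\<beta> t = (sin t)\<^sup>2 * b / 4 * a' + (sin t)^3 * c / 12 * b' + (a * sin t + d / 2 * (sin t)\<^sup>2 * b) * c'" for t
  have "norm (\<phi> (pi / 2) - \<phi> 0) \<le> \<beta> (pi / 2) - \<beta> 0"
  proof (rule differentiable_bound_general[where \<phi>'="\<lambda>t. cos t * bd (sin t)" and f'="\<lambda>t. \<integral>p. f' t p \<partial>(M \<Otimes>\<^sub>M N)"])
    show "continuous_on {0..pi / 2} \<phi>"
      using \<phi>_der by (intro continuous_at_imp_continuous_on) (auto intro: DERIV_isCont)
    show "continuous_on {0..pi / 2} \<beta>"
      unfolding \<beta>_def by (intro continuous_intros) auto
    fix t assume t: "0 < t" "t < pi / 2"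
    show "(\<phi> has_vector_derivative (\<integral>p. f' t p \<partial>(M \<Otimes>\<^sub>M N))) (at t)"
      using \<phi>_der by (simp add: has_real_derivative_iff_has_vector_derivative)
    show "(\<beta> has_vector_derivative cos t * bd (sin t)) (at t)"
      unfolding has_real_derivative_iff_has_vector_derivative[symmetric] \<beta>_def bd_def
      by (auto intro!: derivative_eq_intros simp: field_simps power2_eq_square power3_eq_cube)
    show "norm (\<integral>p. f' t p \<partial>(M \<Otimes>\<^sub>M N)) \<le> cos t * bd (sin t)"
      using \<phi>'_bound[OF t] by simp
  qed simp
  moreover have "\<phi> (pi / 2) = (\<integral>\<omega>. h (W \<omega>) \<partial>M)"
    unfolding \<phi>_iterated by (simp add: f_def X_def N.prob_space)
  moreover have "\<phi> 0 = (\<integral>\<omega>. h (Q *v Z \<omega>) \<partial>N)"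
    unfolding \<phi>_iterated by (simp add: f_def X_def Y_def prob_space)
  ultimately show ?thesis
    by (simp add: \<beta>_def a'_def b'_def c'_def d_def)
qed

end

section \<open>The bound in extended nonnegative reals\<close>

theorem theorem2p1:
  fixes M :: "'a measure" and N :: "'b measure"
    and W W' R :: "'a \<Rightarrow> real^'n" and Z :: "'b \<Rightarrow> real^'n"
    and \<Sigma> \<Lambda> :: "real^'n^'n" and h :: "real^'n \<Rightarrow> real"
  assumes "prob_space M"
    and "exchangeable_pair M W W'"
    and "has_bochner_integral M W 0"
    and "has_bochner_integral M (\<lambda>\<omega>. \<chi> i j. W \<omega> $ i * W \<omega> $ j) \<Sigma>"
    and "transpose \<Sigma> = \<Sigma>" and "positive_definite \<Sigma>"
    and "invertible \<Lambda>"
    and "R \<in> borel_measurable (sigma_gen M W)"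
    and "AE \<omega> in M. \<forall>i. cond_exp_given M W (\<lambda>\<omega>'. W' \<omega>' $ i - W \<omega>' $ i) \<omega> = (- (\<Lambda> *v W \<omega>) + R \<omega>) $ i"
    and "prob_space N"
    and "standard_normal_vector N Z"
    and "three_times_differentiable h"
  shows "ennreal \<bar>(\<integral>\<omega>. h (W \<omega>) \<partial>M) - (\<integral>\<omega>. h (matrix_sqrt \<Sigma> *v Z \<omega>) \<partial>N)\<bar>
    \<le> stein_bound \<Sigma> h (stein_A M W W' \<Lambda>) (stein_B M W W' \<Lambda>) (stein_C M R \<Lambda>)"
proof (cases "\<infinity> \<in> {deriv_norm1 h, deriv_norm2 h, deriv_norm3 h,
    stein_A M W W' \<Lambda>, stein_B M W W' \<Lambda>, stein_C M R \<Lambda>}")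
  case True
  then show ?thesis unfolding stein_bound_def by (simp only: if_True) simp
next
  case False
  then have fin: "deriv_norm1 h < \<infinity>" "deriv_norm2 h < \<infinity>" "deriv_norm3 h < \<infinity>"
    "stein_A M W W' \<Lambda> < \<infinity>" "stein_B M W W' \<Lambda> < \<infinity>" "stein_C M R \<Lambda> < \<infinity>"
    by (auto simp flip: less_top)
  interpret exchangeable_regression M W W' R \<Sigma> \<Lambda>
    using assms by (simp add: exchangeable_regression_def exchangeable_regression_axioms_def)
  obtain g :: "'n \<Rightarrow> real^'n \<Rightarrow> real" and G :: "'n \<Rightarrow> 'n \<Rightarrow> real^'n \<Rightarrow> real" where gG:
    "\<And>x. (h has_derivative (\<lambda>v. \<Sum>m\<in>UNIV. g m x * v $ m)) (at x)"
    "\<And>m x. (g m has_derivative (\<lambda>v. \<Sum>j\<in>UNIV. G m j x * v $ j)) (at x)"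
    "\<And>m x. \<bar>g m x\<bar> \<le> enn2real (deriv_norm1 h)"
    "\<And>m j x. \<bar>G m j x\<bar> \<le> enn2real (deriv_norm2 h)"
    "\<And>m j x y. \<bar>G m j y - G m j x\<bar> \<le> enn2real (deriv_norm3 h) * (\<Sum>k\<in>UNIV. \<bar>y $ k - x $ k\<bar>)"
    using three_times_differentiable_bounds[OF assms(12) fin(1-3)] by blast
  define r where "r = 1 / 2 * real CARD('n) * sqrt (matrix_sup_norm \<Sigma>)"
  have "0 \<le> matrix_sup_norm \<Sigma>"
    using abs_le_matrix_sup_norm[of \<Sigma>] abs_ge_zero order.trans by blast
  then have r: "0 \<le> r" by (simp add: r_def)
  let ?h1 = "enn2real (deriv_norm1 h)" and ?h2 = "enn2real (deriv_norm2 h)" and ?h3 = "enn2real (deriv_norm3 h)"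
    and ?A = "enn2real (stein_A M W W' \<Lambda>)" and ?B = "enn2real (stein_B M W W' \<Lambda>)" and ?C = "enn2real (stein_C M R \<Lambda>)"
  have "\<bar>(\<integral>\<omega>. h (W \<omega>) \<partial>M) - (\<integral>\<omega>. h (matrix_sqrt \<Sigma> *v Z \<omega>) \<partial>N)\<bar>
      \<le> ?h2 / 4 * ?A + ?h3 / 12 * ?B + (?h1 + r * ?h2) * ?C"
    unfolding r_def
    by (rule interpolation_bound[OF assms(10,11) matrix_sqrt_positive_definite[OF assms(5,6)] gG fin(4-6)])
  then have "ennreal \<bar>(\<integral>\<omega>. h (W \<omega>) \<partial>M) - (\<integral>\<omega>. h (matrix_sqrt \<Sigma> *v Z \<omega>) \<partial>N)\<bar>
      \<le> ennreal (?h2 / 4 * ?A + ?h3 / 12 * ?B + (?h1 + r * ?h2) * ?C)"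
    by (rule ennreal_leI)
  also have "\<dots> = ennreal ?h2 / 4 * ennreal ?A + ennreal ?h3 / 12 * ennreal ?B
      + (ennreal ?h1 + ennreal r * ennreal ?h2) * ennreal ?C"
  proof -
    \<comment> \<open>Naming the quotients isolates the two divisions, so that the rest is
      distribution of \<open>ennreal\<close> over sums and products of nonnegative reals.\<close>
    define u v where "u = ?h2 / 4" and "v = ?h3 / 12"
    have "ennreal u = ennreal ?h2 / 4" "ennreal v = ennreal ?h3 / 12" "0 \<le> u" "0 \<le> v"
      using divide_ennreal[of ?h2 4] divide_ennreal[of ?h3 12] by (simp_all add: u_def v_def)
    with r show ?thesis
      unfolding u_def[symmetric] v_def[symmetric] by (simp add: ennreal_plus ennreal_mult)
  qed
  also have "\<dots> = stein_bound \<Sigma> h (stein_A M W W' \<Lambda>) (stein_B M W W' \<Lambda>) (stein_C M R \<Lambda>)"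
    using False fin unfolding stein_bound_def r_def by simp
  finally show ?thesis .
qed

end
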